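(* Let $P_x,P_y\subset\mathbb{R}^d$ be nonempty bounded convex polytopes, not both single points, whose intersection $P_x\cap P_y$ is a nonempty common face of both, with vertices $\mathbf{v}_0,\dots,\mathbf{v}_p$. Let $g$ be a smooth function on a neighborhood of $P_x\times P_y$, and let $\alpha\in\mathbb{R}$ be such that $|\mathbf{x}-\mathbf{y}|^{-\alpha}$ is integrable over $P_x\times P_y$. Apply the pyramidal decomposition algorithm (see context) to $P=P_x\times P_y$ with singular vertices $(\mathbf{v}_k,\mathbf{v}_k)$, $k\in\{0,\dots,p\}$, with any choice of apices. Then $$\int_{P_x}\int_{P_y}|\mathbf{x}-\mathbf{y}|^{-\alpha}g(\mathbf{x},\mathbf{y})\,d\mathbf{y}\,d\mathbf{x}=\sum_{\substack{F_x\times F_y\in\mathcal{L}(P)\\ A_F\in\mathrm{paths}(F_x\times F_y)}}\delta_F\int_0^1\int_{A_F}\int_{F_x}\int_{F_y}|\mathbf{x}_F-\mathbf{y}_F|^{-\alpha}\,g(\mathbf{x},\mathbf{y})\,d\mathbf{y}_F\,d\mathbf{x}_F\,d\mathbf{a}\,(1-\lambda)^{s}\lambda^{r-\alpha}\,d\lambda ,$$ where in each term $A_F\subset\mathbb{R}^{2d}$ is the convex hull of all apices on the path to $F_x\times F_y$, its points are written $(\mathbf{a},\mathbf{a})$, and $$\mathbf{x}=(1-\lambda)\mathbf{a}+\lambda\mathbf{x}_F,\qquad \mathbf{y}=(1-\lambda)\mathbf{a}+\lambda\mathbf{y}_F,$$ $r=\dim(F_x)+\dim(F_y)$, $s=\dim(P_x)+\dim(P_y)-r-1$,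 and $\delta_F=\delta_{AB}$ (see context) with $A=A_F$ and $B=F_x\times F_y$.
   Context: Faces are nonempty; a facet is a face of dimension one less than the polytope. $|\cdot|$ is the Euclidean norm. Integrals over a polytope or face of dimension $j$ in a Euclidean space are with respect to the $j$-dimensional Lebesgue (Hausdorff) measure of its affine hull (counting measure if $j=0$); $d\mathbf{a}$ is this measure on $A_F\subset\mathbb{R}^{2d}$. For a vertex $\mathbf{v}$ of a polytope $F$, $\mathcal{F}(\mathbf{v},F)$ is the set of facets of $F$ not containing $\mathbf{v}$. Pyramidal decomposition algorithm: given a polytope $P$ with some vertices designated as singular, one starts with the face $F=P$. If a face $F$ has no singular vertices, the recursion stops at $F$. Otherwise one selects a singular vertex $\mathbf{v}$ of $F$ (the apex chosen for $F$; one fixed choice for each face $F$) and applies the procedure recursively to every $F'\in\mathcal{F}(\mathbf{v},F)$. The set $\mathcal{L}(P)$ of leaves of the resulting pyramidal lattice is the set of all faces without singular vertices that are reached. Every face of $P_x\times P_y$ has the form $F_x\times F_y$ with $F_x,F_y$ faces of $P_x,P_y$. For $B\in\mathcal{L}(P)$, $\mathrm{paths}(B)$ is the set of all paths $P=F^{0},F^{1},\dots,F^{\ell+1}=B$ with $F^{j+1}\in\mathcal{F}(\mathbf{u}_j,F^{j})$, where $\mathbf{u}_j$ is the apex chosen for $F^{j}$; a path is identified with its apices, and the set $A_F$ associated with a path is the simplex $[\mathbf{u}_0,\dots,\mathbf{u}_\ell]$ (convex hull of the apices). Since all apices are of the form $(\mathbf{v}_k,\mathbf{v}_k)$, all points of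 $A_F$ have the form $(\mathbf{a},\mathbf{a})$. Definition of $\delta_{AB}$: let $A,B$ be polytopes in a Euclidean space with $\mathrm{aff}(A)\cap\mathrm{aff}(B)=\emptyset$ and $H_A\cap H_B=\{\mathbf{0}\}$, where $H_F$ is the linear space parallel to $\mathrm{aff}(F)$. Let the columns of $T_A$, $T_B$ be bases of $H_A$, $H_B$ and let $\mathbf{v}\in\mathrm{aff}(A)$, $\mathbf{w}\in\mathrm{aff}(B)$. Let $R$, $R_A$, $R_B$ be the upper triangular factors (with positive diagonal) in the QR-factorizations of $[T_A,\,T_B,\,\mathbf{w}-\mathbf{v}]$, $T_A$ and $T_B$, respectively (the determinant of an empty matrix is $1$). Then $$\delta_{AB}=\frac{\det(R)}{\det(R_A)\det(R_B)},$$ which does not depend on the choices of $T_A,T_B,\mathbf{v},\mathbf{w}$. *)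

theory Defs
  imports "Jordan_Normal_Form.Determinant" "HOL-Analysis.Analysis"
begin

section \<open>Smooth functions\<close>

text \<open>\<open>Ck_on k U f\<close> is meant for open \<open>U\<close>: \<open>f\<close> is \<open>k\<close> times continuously differentiable on \<open>U\<close>.\<close>

primrec Ck_on :: "nat \<Rightarrow> 'a::real_normed_vector set \<Rightarrow> ('a \<Rightarrow> 'b::real_normed_vector) \<Rightarrow> bool" where
  "Ck_on 0 U f \<longleftrightarrow> continuous_on U f"
| "Ck_on (Suc k) U f \<longleftrightarrow>
     (\<forall>x\<in>U. f differentiable (at x)) \<and> (\<forall>v. Ck_on k U (\<lambda>x. frechet_derivative f (at x) v))"

definition smooth_on :: "'a::real_normed_vector set \<Rightarrow> ('a \<Rightarrow> 'b::real_normed_vector) \<Rightarrow> bool" where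
  "smooth_on U f \<longleftrightarrow> (\<forall>k. Ck_on k U f)"


section \<open>Lebesgue measure on an affine hull\<close>

definition direction :: "'a::euclidean_space set \<Rightarrow> 'a set" where
  "direction F = {x - y | x y. x \<in> affine hull F \<and> y \<in> affine hull F}"

definition orthonormal_basis_of :: "'a::euclidean_space set \<Rightarrow> 'a set \<Rightarrow> bool" where
  "orthonormal_basis_of H B \<longleftrightarrow>
     B \<subseteq> H \<and> pairwise orthogonal B \<and> (\<forall>b\<in>B. norm b = 1) \<and> span B = H"

text \<open>
  The image of the standard Lebesgue measure on \<open>\<real>\<^sup>B\<close> under an isometry
  onto the affine hull of a nonempty set \<open>F\<close>; the result depends neither on the base point
  nor on the orthonormal basis \<open>B\<close> (cf. \<open>lborel_eq\<close> for the case of the full space).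
  If \<open>F\<close> is a single point then \<open>B = {}\<close> and this is the counting measure of that point.
\<close>

definition aff_lborel :: "'a::euclidean_space set \<Rightarrow> 'a measure" where
  "aff_lborel F =
     (let v = (SOME v. v \<in> affine hull F);
          B = (SOME B. orthonormal_basis_of (direction F) B)
      in distr (\<Pi>\<^sub>M b\<in>B. lborel) borel (\<lambda>c. v + (\<Sum>b\<in>B. c b *\<^sub>R b)))"


section \<open>The factor \<open>\<delta>\<^sub>A\<^sub>B\<close>\<close>

text \<open>
  The matrix with columns \<open>cs\<close> is \<open>Q * R\<close>, where \<open>Q\<close> has the orthonormal columns \<open>qs\<close> and
  \<open>R\<close> is the square upper triangular factor.
\<close>

definition QR_upper_factor :: "'a::euclidean_space list \<Rightarrow> real mat \<Rightarrow> bool" where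
  "QR_upper_factor cs R \<longleftrightarrow>
     (let m = length cs in
        R \<in> carrier_mat m m \<and> upper_triangular R \<and> (\<forall>i<m. R $$ (i, i) > 0) \<and>
        (\<exists>qs. length qs = m \<and>
              (\<forall>i<m. \<forall>j<m. qs ! i \<bullet> qs ! j = (if i = j then 1 else 0)) \<and>
              (\<forall>j<m. cs ! j = (\<Sum>i<m. R $$ (i, j) *\<^sub>R qs ! i))))"

definition basis_list_of :: "'a::euclidean_space set \<Rightarrow> 'a list \<Rightarrow> bool" where
  "basis_list_of H T \<longleftrightarrow> distinct T \<and> independent (set T) \<and> span (set T) = H"

text \<open>
  Only meaningful if the affine hulls of \<open>A\<close> and \<open>B\<close> are disjoint and their directions meet
  only in \<open>0\<close>; then every choice of the bases \<open>TA\<close>, \<open>TB\<close> and of the points \<open>v\<close>, \<open>w\<close>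
  yields the same value.
\<close>

definition delta :: "'a::euclidean_space set \<Rightarrow> 'a set \<Rightarrow> real" where
  "delta A B =
     (SOME \<delta>. \<exists>TA TB v w R RA RB.
        basis_list_of (direction A) TA \<and> basis_list_of (direction B) TB \<and>
        v \<in> affine hull A \<and> w \<in> affine hull B \<and>
        QR_upper_factor (TA @ TB @ [w - v]) R \<and> QR_upper_factor TA RA \<and> QR_upper_factor TB RB \<and>
        \<delta> = Determinant.det R / (Determinant.det RA * Determinant.det RB))"


section \<open>Pyramidal decomposition\<close>

text \<open>
  Throughout, \<open>P\<close> is a polytope, \<open>S\<close> the set of its vertices designated as singular, and
  \<open>apex\<close> assigns to each face the singular vertex selected by the algorithm.
\<close>

definition opposite_facets :: "'a::euclidean_space \<Rightarrow> 'a set \<Rightarrow> 'a set set" where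
  "opposite_facets v F = {F'. F' facet_of F \<and> v \<notin> F'}"

definition singular_vertices :: "'a::euclidean_space set \<Rightarrow> 'a set \<Rightarrow> 'a set" where
  "singular_vertices S F = {v \<in> S. v extreme_point_of F}"

definition apex_choice :: "'a::euclidean_space set \<Rightarrow> 'a set \<Rightarrow> ('a set \<Rightarrow> 'a) \<Rightarrow> bool" where
  "apex_choice P S apex \<longleftrightarrow>
     (\<forall>F. F face_of P \<and> singular_vertices S F \<noteq> {} \<longrightarrow> apex F \<in> singular_vertices S F)"

definition pyr_step :: "'a::euclidean_space set \<Rightarrow> ('a set \<Rightarrow> 'a) \<Rightarrow> 'a set \<Rightarrow> 'a set \<Rightarrow> bool" where
  "pyr_step S apex F F' \<longleftrightarrow> singular_vertices S F \<noteq> {} \<and> F' \<in> opposite_facets (apex F) F"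

definition pyr_leaves :: "'a::euclidean_space set \<Rightarrow> 'a set \<Rightarrow> ('a set \<Rightarrow> 'a) \<Rightarrow> 'a set set" where
  "pyr_leaves P S apex = {B. (pyr_step S apex)\<^sup>*\<^sup>* P B \<and> singular_vertices S B = {}}"

text \<open>A path is represented by its list of faces, from \<open>P\<close> down to \<open>B\<close>.\<close>

definition pyr_paths ::
    "'a::euclidean_space set \<Rightarrow> 'a set \<Rightarrow> ('a set \<Rightarrow> 'a) \<Rightarrow> 'a set \<Rightarrow> 'a set list set" where
  "pyr_paths P S apex B =
     {Fs. Fs \<noteq> [] \<and> hd Fs = P \<and> last Fs = B \<and>
          (\<forall>j. Suc j < length Fs \<longrightarrow> pyr_step S apex (Fs ! j) (Fs ! Suc j))}"

text \<open>The last face of a path, its leaf, has no apex.\<close>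

definition path_simplex :: "('a::euclidean_space set \<Rightarrow> 'a) \<Rightarrow> 'a set list \<Rightarrow> 'a set" where
  "path_simplex apex Fs = convex hull (apex ` set (butlast Fs))"

definition diag_vertices :: "'a::euclidean_space set \<Rightarrow> ('a \<times> 'a) set" where
  "diag_vertices K = {(v, v) | v. v extreme_point_of K}"

end

(*
  The join of a polytope B with a simplex A whose affine hull is skew to that of B is
  parametrized by (lambda, a, b) |-> (1 - lambda) a + lambda b, with constant factor delta times
  (1 - lambda)^dim A * lambda^dim B.  A polytope F with a point u in it is the union of the cones
  with apex u over the facets that avoid u, and two such cones meet in a set of smaller dimension;
  this remains true after joining everything with a simplex skew to F.  Hence P is tiled, up to
  null sets, by the joins of the path simplices with their leaves, and homogeneity of
  |x - y|^(-alpha) gives the formula.  The only dead end of the decomposition would be a face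
  consisting of one singular vertex (v, v); its parent would contain (v, v) and (w, w) with v <> w,
  hence, being a product, would have dimension at least 2, so this never happens.

  The measures of affine hulls are compared through iterated one-dimensional integrals along a list
  of vectors, which change by an elementary factor when one vector is exchanged.
*)

theory Submission
  imports Defs "HOL-Probability.Distributions"
begin

section \<open>Iterated integrals along a list of vectors\<close>

text \<open>\<open>aff_lborel\<close> hides two arbitrary choices, a base point and an orthonormal
  basis. The constant of a change of basis depends neither on the integrand nor on the base point,
  so a single test function, the Gaussian, shows that orthonormal bases agree. The factor \<delta>
  arises when the measures of A, B and their union are rewritten in the bases T_A, T_B and T_A, T_B,
  w - v: each measure carries the determinant of its own triangular factor, and the quotient
  remains. This is done for nonnegative integrands, where Tonelli asks for no integrability, and
  then turned into an identity of measures, which serves signed integrands as well. The tiling does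
  not follow by induction on faces alone, since earlier apexes are joined to all later faces. The
  induction therefore runs over pairs of a set A of former apexes and a face F skew to A: one step
  moves one dimension from F to A and leaves the affine hull of the union, hence the reference
  measure, unchanged.\<close>

text \<open>For independent \<open>ts\<close> this is integration over the flat through
  \<open>v\<close> along the span of \<open>ts\<close>, normalized so that the parallelepiped
  spanned by \<open>ts\<close> has volume 1. A list is used because exchanges and triangular factors
  work position by position.\<close>

primrec span_integral :: "'a::euclidean_space list \<Rightarrow> ('a \<Rightarrow> ennreal) \<Rightarrow> 'a \<Rightarrow> ennreal" where
  "span_integral [] f v = f v"
| "span_integral (t # ts) f v = (\<integral>\<^sup>+c. span_integral ts f (v + c *\<^sub>R t) \<partial>lborel)"

lemma span_integral_measurable [measurable]:
  "f \<in> borel_measurable borel \<Longrightarrow> span_integral ts f \<in> borel_measurable borel"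
proof (induction ts)
  case (Cons t ts)
  then have [measurable]: "span_integral ts f \<in> borel_measurable borel" by simp
  show ?case by simp
next
  case Nil
  then show ?case by (simp cong: measurable_cong)
qed

lemma span_integral_append:
  "span_integral (ts @ ss) f v = span_integral ts (span_integral ss f) v"
  by (induction ts arbitrary: v) auto

lemma span_integral_shift:
  "span_integral ts (\<lambda>u. f (u + s)) v = span_integral ts f (v + s)"
  by (induction ts arbitrary: v) (auto simp: algebra_simps)

lemma span_integral_cmult:
  assumes [measurable]: "f \<in> borel_measurable borel"
  shows "span_integral ts (\<lambda>u. k * f u) v = k * span_integral ts f v"
  by (induction ts arbitrary: v) (auto simp: nn_integral_cmult)

lemma span_integral_swap:
  assumes [measurable]: "f \<in> borel_measurable borel"
  shows "span_integral (s # t # ts) f v = span_integral (t # s # ts) f v"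
proof -
  have "(\<integral>\<^sup>+c. \<integral>\<^sup>+d. span_integral ts f (v + c *\<^sub>R s + d *\<^sub>R t) \<partial>lborel \<partial>lborel)
      = (\<integral>\<^sup>+d. \<integral>\<^sup>+c. span_integral ts f (v + c *\<^sub>R s + d *\<^sub>R t) \<partial>lborel \<partial>lborel)"
    by (rule lborel_pair.Fubini'[symmetric]) measurable
  then show ?thesis by (simp add: algebra_simps)
qed

lemma span_integral_move:
  assumes [measurable]: "f \<in> borel_measurable borel"
  shows "span_integral (ts @ s # ss) f v = span_integral (s # ts @ ss) f v"
proof (induction ts arbitrary: v)
  case (Cons t ts)
  have "span_integral ((t # ts) @ s # ss) f v = span_integral (t # s # ts @ ss) f v"
    using Cons by simp
  then show ?case using span_integral_swap[OF assms, of t s "ts @ ss" v] by simp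
qed simp

text \<open>Any permutation is built from adjacent transpositions, each of which is Tonelli's
  theorem for two copies of the line.\<close>

lemma span_integral_mset:
  assumes [measurable]: "f \<in> borel_measurable borel" and "mset ts = mset ss"
  shows "span_integral ts f v = span_integral ss f v"
  using assms(2)
proof (induction ts arbitrary: ss v)
  case (Cons t ts)
  then have "t \<in> set ss" by (metis list.set_intros(1) set_mset_mset)
  then obtain a b where ss: "ss = a @ t # b" by (meson split_list)
  with Cons.prems have "mset ts = mset (a @ b)" by simp
  from Cons.IH[OF this] have "span_integral (t # ts) f v = span_integral (t # a @ b) f v" by simp
  then show ?case using span_integral_move[OF assms(1)] ss by metis
qed simp

text \<open>Only the flat through \<open>v\<close> matters: the component of \<open>s\<close> along
  each vector is absorbed by translation invariance of one-dimensional Lebesgue measure.\<close>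

lemma span_integral_translate:
  assumes [measurable]: "f \<in> borel_measurable borel" and "s \<in> span (set ts)"
  shows "span_integral ts f (v + s) = span_integral ts f v"
  using assms(2)
proof (induction ts arbitrary: v s)
  case (Cons t ts)
  then obtain k where k: "s - k *\<^sub>R t \<in> span (set ts)"
    using span_breakdown_eq[of s t "set ts"] by auto
  have "span_integral (t # ts) f (v + s)
      = (\<integral>\<^sup>+c. span_integral ts f ((v + (k + c) *\<^sub>R t) + (s - k *\<^sub>R t)) \<partial>lborel)"
    by (simp add: algebra_simps)
  also have "\<dots> = (\<integral>\<^sup>+c. span_integral ts f (v + (k + c) *\<^sub>R t) \<partial>lborel)"
    using Cons.IH[OF k] by simp
  also have "\<dots> = span_integral (t # ts) f v"
    using nn_integral_real_affine[of "\<lambda>c. span_integral ts f (v + c *\<^sub>R t)" 1 k] by simp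
  finally show ?case .
qed (simp)

text \<open>An elementary column operation. The shear by \<open>s\<close> is invisible to the
  remaining integrations, and the factor \<open>b\<close> is a one-dimensional substitution.\<close>

lemma span_integral_exchange:
  assumes [measurable]: "f \<in> borel_measurable borel" and s: "s \<in> span (set ts)" and b: "b \<noteq> 0"
  shows "span_integral (t # ts) f v = ennreal \<bar>b\<bar> * span_integral ((b *\<^sub>R t + s) # ts) f v"
proof -
  have "span_integral ((b *\<^sub>R t + s) # ts) f v
      = (\<integral>\<^sup>+c. span_integral ts f ((v + (b * c) *\<^sub>R t) + c *\<^sub>R s) \<partial>lborel)"
    by (simp add: algebra_simps)
  also have "\<dots> = (\<integral>\<^sup>+c. span_integral ts f (v + (b * c) *\<^sub>R t) \<partial>lborel)"
    using span_integral_translate[OF assms(1) span_scale[OF s]] by simp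
  finally show ?thesis
    using nn_integral_real_affine[of "\<lambda>c. span_integral ts f (v + c *\<^sub>R t)" b 0] b by simp
qed

lemma span_integral_scale:
  assumes [measurable]: "f \<in> borel_measurable borel" and c: "c \<noteq> 0"
  shows "span_integral ts f (c *\<^sub>R v)
       = ennreal (\<bar>c\<bar> ^ length ts) * span_integral ts (\<lambda>u. f (c *\<^sub>R u)) v"
proof (induction ts arbitrary: v)
  case (Cons t ts)
  have "span_integral (t # ts) f (c *\<^sub>R v)
      = ennreal \<bar>c\<bar> * (\<integral>\<^sup>+x. span_integral ts f (c *\<^sub>R (v + x *\<^sub>R t)) \<partial>lborel)"
    using nn_integral_real_affine[of "\<lambda>x. span_integral ts f (c *\<^sub>R v + x *\<^sub>R t)" c 0] c
    by (simp add: algebra_simps)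
  also have "\<dots> = ennreal \<bar>c\<bar> * (ennreal (\<bar>c\<bar> ^ length ts) *
      span_integral (t # ts) (\<lambda>u. f (c *\<^sub>R u)) v)"
    by (simp add: Cons nn_integral_cmult)
  finally show ?case by (simp add: ennreal_mult mult.assoc)
qed simp

section \<open>Exchange of basis vectors and the constant it costs\<close>

text \<open>The search for the vector to be exchanged: since \<open>t\<close> is outside the span of
  \<open>A\<close>, some member of \<open>S\<close> enters it with nonzero coefficient
  \<open>b\<close>. The split of \<open>S\<close> records its position so that it can be
  removed.\<close>

lemma span_pick:
  fixes t :: "'a::euclidean_space"
  assumes "t \<in> span (A \<union> set S)" "t \<notin> span A"
  shows "\<exists>S1 s S2 b w. S = S1 @ s # S2 \<and> w \<in> span (A \<union> set (S1 @ S2)) \<and> b \<noteq> 0 \<and> t = b *\<^sub>R s + w"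
  using assms
proof (induction S arbitrary: A)
  case (Cons s S)
  obtain k where k: "t - k *\<^sub>R s \<in> span (A \<union> set S)"
    using Cons.prems(1) span_breakdown_eq[of t s "A \<union> set S"] by auto
  show ?case
  \<comment> \<open>With \<open>k = 0\<close> the head contributes nothing and the search continues
    in the tail; otherwise the head itself is the vector sought.\<close>
  proof (cases "k = 0")
    case True
    then have "t \<in> span (A \<union> set S)" using k by simp
    from Cons.IH[OF this Cons.prems(2)] obtain S1 s' S2 b w where
      *: "S = S1 @ s' # S2" "w \<in> span (A \<union> set (S1 @ S2))" "b \<noteq> 0" "t = b *\<^sub>R s' + w" by blast
    have "w \<in> span (A \<union> set ((s # S1) @ S2))"
      using *(2) span_mono[of "A \<union> set (S1 @ S2)" "A \<union> set ((s # S1) @ S2)"] by auto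
    then show ?thesis using * by (metis append_Cons)
  next
    case False
    then show ?thesis using k
      by (intro exI[of _ "[]"] exI[of _ s] exI[of _ S] exI[of _ k] exI[of _ "t - k *\<^sub>R s"]) auto
  qed
qed simp

text \<open>Steinitz exchange, with the factor recorded at every step. The order of quantifiers is
  the point: \<open>c\<close> is fixed before \<open>f\<close> and \<open>v\<close>, so it can later
  be evaluated on one convenient function.\<close>

lemma span_integral_steinitz:
  fixes T T' :: "'a::euclidean_space list"
  assumes "distinct T'" "independent (set T')" "set T' \<subseteq> span (set T)"
  shows "\<exists>S c. c > 0 \<and> length T = length T' + length S \<and> span (set (T' @ S)) = span (set T) \<and>
           (\<forall>f\<in>borel_measurable borel. \<forall>v.
              span_integral T f v = ennreal c * span_integral (T' @ S) f v)"
  using assms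
proof (induction T')
  case Nil
  show ?case by (intro exI[of _ T] exI[of _ 1]) auto
next
  case (Cons t T')
  then have "independent (set T')" "t \<notin> span (set T')"
    by (auto simp: independent_insert)
  with Cons obtain S c where c: "c > 0" "length T = length T' + length S"
    "span (set (T' @ S)) = span (set T)"
    "\<And>f v. f \<in> borel_measurable borel \<Longrightarrow> span_integral T f v = ennreal c * span_integral (T' @ S) f v"
    by auto
  have "t \<in> span (set T' \<union> set S)" using Cons.prems c(3) by auto
  from span_pick[OF this \<open>t \<notin> _\<close>] obtain S1 s S2 b w where
    S: "S = S1 @ s # S2" and w: "w \<in> span (set T' \<union> set (S1 @ S2))" and b: "b \<noteq> 0"
    and t: "t = b *\<^sub>R s + w" by blast
  let ?R = "T' @ S1 @ S2"
  have sR: "s - inverse b *\<^sub>R t \<in> span (set ?R)"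
  proof -
    have "s - inverse b *\<^sub>R t = - inverse b *\<^sub>R w" using b t by (simp add: algebra_simps)
    then show ?thesis using w by (metis set_append span_scale)
  qed
  have tR: "t - b *\<^sub>R s \<in> span (set ?R)" using w t by simp
  \<comment> \<open>Modulo the span of \<open>?R\<close>, \<open>s\<close> and \<open>t\<close> are
    nonzero multiples of each other, so either one completes \<open>?R\<close> to the same
    span.\<close>
  have 1: "span (insert t (set ?R)) = span (insert s (set ?R))"
  proof (rule span_eq[THEN iffD2], intro conjI subsetI)
    fix x assume "x \<in> insert t (set ?R)"
    then show "x \<in> span (insert s (set ?R))"
      using tR span_breakdown_eq[of t s "set ?R"] by (auto intro: span_base)
  next
    fix x assume "x \<in> insert s (set ?R)"
    then show "x \<in> span (insert t (set ?R))"
      using sR span_breakdown_eq[of s t "set ?R"] by (auto intro: span_base)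
  qed
  have "span (set ((t # T') @ S1 @ S2)) = span (set T)"
    using 1 c(3) S by (simp add: Un_assoc insert_commute)
  moreover have "span_integral T f v = ennreal (c * \<bar>b\<bar>) * span_integral ((t # T') @ S1 @ S2) f v"
    if f: "f \<in> borel_measurable borel" for f v
  proof -
    have "span_integral (T' @ S) f v = span_integral (s # ?R) f v"
      using f S by (intro span_integral_mset) auto
    also have "\<dots> = ennreal \<bar>b\<bar> * span_integral (t # ?R) f v"
      using span_integral_exchange[OF f _ b, of w ?R s v] w t by simp
    finally show ?thesis using c(4)[OF f, of v] c(1) by (simp add: ennreal_mult mult.assoc)
  qed
  ultimately show ?case using c S b
    by (intro exI[of _ "S1 @ S2"] exI[of _ "c * \<bar>b\<bar>"]) auto
qed

lemma length_eq_dim: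
  "distinct T \<Longrightarrow> independent (set T) \<Longrightarrow> length T = dim (span (set T))"
  by (metis dim_eq_card_independent dim_span distinct_card)

text \<open>Two bases of one subspace have equal length, so the Steinitz exchange leaves no vector
  of the old basis over.\<close>

lemma span_integral_change_basis:
  fixes T T' :: "'a::euclidean_space list"
  assumes "distinct T" "independent (set T)" "distinct T'" "independent (set T')"
    "span (set T) = span (set T')"
  obtains c where "c > 0" "\<And>f v. f \<in> borel_measurable borel \<Longrightarrow>
     span_integral T f v = ennreal c * span_integral T' f v"
proof -
  have "set T' \<subseteq> span (set T)" using assms by (simp add: span_superset)
  from span_integral_steinitz[OF assms(3,4) this] obtain S c where
    *: "c > 0" "length T = length T' + length S"
    "\<And>f v. f \<in> borel_measurable borel \<Longrightarrow> span_integral T f v = ennreal c * span_integral (T' @ S) f v"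
    by auto
  have "length T = length T'" using assms length_eq_dim by metis
  with * that show ?thesis by auto
qed

section \<open>Orthonormal bases and the Gaussian normalization\<close>

definition orthonormal_list :: "'a::euclidean_space list \<Rightarrow> bool" where
  "orthonormal_list Q \<longleftrightarrow> distinct Q \<and> pairwise orthogonal (set Q) \<and> (\<forall>q\<in>set Q. norm q = 1)"

lemma orthonormal_list_independent: "orthonormal_list Q \<Longrightarrow> independent (set Q)"
  unfolding orthonormal_list_def by (rule pairwise_orthogonal_independent) auto

lemma orthonormal_list_Cons:
  "orthonormal_list (q # Q) \<longleftrightarrow>
     orthonormal_list Q \<and> norm q = 1 \<and> (\<forall>x\<in>set Q. inner q x = 0)"
proof -
  have "q \<notin> set Q" if "norm q = 1" "\<forall>x\<in>set Q. inner q x = 0"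
    using that by (metis norm_eq_zero inner_eq_zero_iff zero_neq_one)
  then show ?thesis
    unfolding orthonormal_list_def by (auto simp: pairwise_insert orthogonal_def inner_commute)
qed

definition gauss_const :: ennreal where
  "gauss_const = (\<integral>\<^sup>+c. ennreal (exp (- c\<^sup>2)) \<partial>lborel)"

lemma gauss_const_finite: "gauss_const < \<infinity>"
  and gauss_const_pos: "gauss_const > 0"
proof -
  have g: "has_bochner_integral lborel (\<lambda>x::real. exp (- x\<^sup>2)) (2 *\<^sub>R (sqrt pi / 2))"
    using gaussian_moment_0 by (rule has_bochner_integral_even_function) auto
  then have eq: "gauss_const = ennreal (sqrt pi)"
    unfolding gauss_const_def
    by (subst nn_integral_eq_integral)
       (auto simp: has_bochner_integral_iff)
  show "gauss_const < \<infinity>" unfolding eq by simp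
  show "gauss_const > 0" unfolding eq by simp
qed

text \<open>A Gaussian has the same positive finite integral over all flats of the same dimension through
  its centre; hence two orthonormal bases of a subspace yield the same integral.\<close>

lemma span_integral_gauss:
  assumes "orthonormal_list Q" "\<And>q. q \<in> set Q \<Longrightarrow> inner w q = 0"
  shows "span_integral Q (\<lambda>u. ennreal (exp (- (norm (u - v))\<^sup>2))) (v + w)
       = ennreal (exp (- (norm w)\<^sup>2)) * gauss_const ^ length Q"
  using assms
proof (induction Q arbitrary: w)
  case (Cons q Q)
  \<comment> \<open>Pythagoras: the offset \<open>w\<close> is orthogonal to \<open>q\<close>.
    Allowing an offset is what lets the induction peel off one vector at a time.\<close>
  have n: "(norm (w + c *\<^sub>R q))\<^sup>2 = (norm w)\<^sup>2 + c\<^sup>2" for c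
    using Cons.prems(2)[of q] Cons.prems(1)
    by (simp add: dot_square_norm[symmetric] orthonormal_list_Cons inner_add_left inner_add_right
        inner_commute norm_eq_1) (simp add: power2_eq_square)
  have "span_integral (q # Q) (\<lambda>u. ennreal (exp (- (norm (u - v))\<^sup>2))) (v + w)
    = (\<integral>\<^sup>+c. span_integral Q (\<lambda>u. ennreal (exp (- (norm (u - v))\<^sup>2))) (v + (w + c *\<^sub>R q)) \<partial>lborel)"
    by (simp add: add.assoc)
  also have "\<dots> = (\<integral>\<^sup>+c. ennreal (exp (- (norm w)\<^sup>2)) * gauss_const ^ length Q * ennreal (exp (- c\<^sup>2)) \<partial>lborel)"
  proof (intro nn_integral_cong)
    fix c
    have "span_integral Q (\<lambda>u. ennreal (exp (- (norm (u - v))\<^sup>2))) (v + (w + c *\<^sub>R q))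
        = ennreal (exp (- (norm (w + c *\<^sub>R q))\<^sup>2)) * gauss_const ^ length Q"
      using Cons.prems by (intro Cons.IH) (auto simp: orthonormal_list_Cons inner_add_left)
    also have "ennreal (exp (- (norm (w + c *\<^sub>R q))\<^sup>2))
        = ennreal (exp (- (norm w)\<^sup>2)) * ennreal (exp (- c\<^sup>2))"
      unfolding n by (simp add: exp_add[symmetric] ennreal_mult[symmetric])
    finally show "span_integral Q (\<lambda>u. ennreal (exp (- (norm (u - v))\<^sup>2))) (v + (w + c *\<^sub>R q))
        = ennreal (exp (- (norm w)\<^sup>2)) * gauss_const ^ length Q * ennreal (exp (- c\<^sup>2))"
      by (simp add: ac_simps)
  qed
  also have "\<dots> = ennreal (exp (- (norm w)\<^sup>2)) * gauss_const ^ length Q * gauss_const"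
    unfolding gauss_const_def by (rule nn_integral_cmult) simp
  finally show ?case by (simp add: ac_simps)
qed simp

lemma span_integral_orthonormal_eq:
  assumes Q: "orthonormal_list Q" "orthonormal_list Q'" "span (set Q) = span (set Q')"
    and f: "f \<in> borel_measurable borel"
  shows "span_integral Q f v = span_integral Q' f v"
proof -
  have d: "distinct Q" "independent (set Q)" "distinct Q'" "independent (set Q')"
    using Q orthonormal_list_independent by (auto simp: orthonormal_list_def)
  obtain c where c: "c > 0" "\<And>f v. f \<in> borel_measurable borel \<Longrightarrow>
     span_integral Q f v = ennreal c * span_integral Q' f v"
    using span_integral_change_basis[OF d Q(3)] by blast
  have len: "length Q = length Q'" using d Q(3) length_eq_dim by metis
  let ?g = "\<lambda>u. ennreal (exp (- (norm (u - v))\<^sup>2))"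
  \<comment> \<open>Testing with the Gaussian centred at \<open>v\<close> determines
    \<open>c\<close>; the cancellation in \<open>ennreal\<close> is legitimate because the common
    value is neither zero nor infinite.\<close>
  have "gauss_const ^ length Q = ennreal c * gauss_const ^ length Q"
    using c(2)[of ?g v] span_integral_gauss[of Q 0 v] span_integral_gauss[of Q' 0 v] Q len by simp
  moreover have "gauss_const ^ length Q \<noteq> 0" "gauss_const ^ length Q \<noteq> \<infinity>"
    using gauss_const_pos gauss_const_finite
    by (auto simp: power_eq_top_ennreal)
  ultimately have "ennreal c = 1"
    by (metis ennreal_mult_cancel_left infinity_ennreal_def mult.commute mult.right_neutral)
  then show ?thesis using c(2)[OF f] by simp
qed

section \<open>Lebesgue measure on affine hulls\<close>

lemma span_integral_cong_span:
  assumes "\<And>s. s \<in> span (set ts) \<Longrightarrow> f (v + s) = g (v + s)"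
  shows "span_integral ts f v = span_integral ts g v"
  using assms
proof (induction ts arbitrary: v)
  case Nil
  then show ?case using Nil[of 0] by simp
next
  case (Cons t ts)
  have "span_integral ts f (v + c *\<^sub>R t) = span_integral ts g (v + c *\<^sub>R t)" for c
  proof (rule Cons.IH)
    fix s assume "s \<in> span (set ts)"
    then have "c *\<^sub>R t + s \<in> span (set (t # ts))"
      using span_mono[of "set ts" "set (t # ts)"]
      by (intro span_add span_scale) (auto intro: span_base)
    then show "f (v + c *\<^sub>R t + s) = g (v + c *\<^sub>R t + s)"
      using Cons.prems by (simp add: add.assoc)
  qed
  then show ?case by simp
qed

lemma span_integral_mono:
  assumes "\<And>u. f u \<le> g u"
  shows "span_integral ts f v \<le> span_integral ts g v"
  using assms by (induction ts arbitrary: v) (auto intro: nn_integral_mono)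

lemma span_integral_zero: "span_integral ts (\<lambda>_. 0) v = 0"
  by (induction ts arbitrary: v) auto

lemma direction_eq_image:
  assumes "v \<in> affine hull F"
  shows "direction F = (\<lambda>x. x - v) ` (affine hull F)"
proof -
  have sub: "subspace ((\<lambda>x. x - v) ` (affine hull F))"
    using affine_diffs_subspace_subtract[OF affine_affine_hull assms] .
  have "x - y \<in> (\<lambda>x. x - v) ` (affine hull F)"
    if "x \<in> affine hull F" "y \<in> affine hull F" for x y
    using subspace_diff[OF sub, of "x - v" "y - v"] that by auto
  then show ?thesis using assms unfolding direction_def by blast
qed

lemma subspace_direction: "F \<noteq> {} \<Longrightarrow> subspace (direction F)"
  by (metis direction_eq_image affine_affine_hull affine_diffs_subspace_subtract all_not_in_conv hull_inc)

lemma mem_affine_hull_direction: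
  assumes "v \<in> affine hull F"
  shows "x \<in> affine hull F \<longleftrightarrow> x - v \<in> direction F"
  using direction_eq_image[OF assms] by force

lemma dim_direction:
  assumes "F \<noteq> {}"
  shows "int (dim (direction F)) = aff_dim F"
proof -
  obtain v where v: "v \<in> affine hull F" using assms hull_inc by fastforce
  then show ?thesis
    using aff_dim_eq_dim_subtract[of v "affine hull F"] direction_eq_image[OF v] by simp
qed

lemma direction_eq_span:
  assumes "v \<in> affine hull F"
  shows "direction F = span ((\<lambda>x. x - v) ` F)"
proof (rule antisym)
  have F: "F \<noteq> {}" using assms by auto
  show "span ((\<lambda>x. x - v) ` F) \<subseteq> direction F"
    using direction_eq_image[OF assms] by (intro span_minimal subspace_direction F) (auto intro: hull_inc)
  have "F \<subseteq> (\<lambda>s. v + s) ` span ((\<lambda>x. x - v) ` F)"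
  proof
    fix x assume "x \<in> F"
    then have "x - v \<in> span ((\<lambda>x. x - v) ` F)" by (intro span_base) simp
    then show "x \<in> (\<lambda>s. v + s) ` span ((\<lambda>x. x - v) ` F)"
      by (intro image_eqI[of _ _ "x - v"]) auto
  qed
  then have "affine hull F \<subseteq> (\<lambda>s. v + s) ` span ((\<lambda>x. x - v) ` F)"
    by (intro hull_minimal) (auto simp: affine_translation[symmetric] subspace_imp_affine)
  then show "direction F \<subseteq> span ((\<lambda>x. x - v) ` F)"
    unfolding direction_eq_image[OF assms] by auto
qed

text \<open>One vector joining the two hulls, together with both directions, reaches everything.
  This is the origin of the extra column w - v in the matrix that defines \<delta>.\<close>

lemma direction_Un:
  assumes "v \<in> affine hull A" "w \<in> affine hull B"
    and "span TA = direction A" "span TB = direction B"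
  shows "span (insert (w - v) (TA \<union> TB)) = direction (A \<union> B)"
proof (rule antisym)
  let ?S = "span (insert (w - v) (TA \<union> TB))"
  have aff: "affine hull A \<subseteq> affine hull (A \<union> B)" "affine hull B \<subseteq> affine hull (A \<union> B)"
    by (simp_all add: hull_mono)
  have ne: "A \<union> B \<noteq> {}" using assms by auto
  have "insert (w - v) (TA \<union> TB) \<subseteq> direction (A \<union> B)"
  proof -
    have "direction A \<subseteq> direction (A \<union> B)" "direction B \<subseteq> direction (A \<union> B)"
      using aff unfolding direction_def by blast+
    moreover have "w - v \<in> direction (A \<union> B)"
      using assms(1,2) aff unfolding direction_def by blast
    ultimately show ?thesis
      using assms(3,4) span_superset[of TA] span_superset[of TB] by auto
  qed
  then show "?S \<subseteq> direction (A \<union> B)"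
    by (intro span_minimal subspace_direction ne)
  have TA: "direction A \<subseteq> ?S" "direction B \<subseteq> ?S"
    unfolding assms(3,4)[symmetric] by (auto intro!: span_mono)
  have "x - v \<in> ?S" if "x \<in> A \<union> B" for x
  proof (cases "x \<in> A")
    case True
    then have "x - v \<in> direction A"
      using mem_affine_hull_direction[OF assms(1), of x] by (simp add: hull_inc)
    then show ?thesis using TA(1) by blast
  next
    case False
    then have "x - w \<in> direction B"
      using that mem_affine_hull_direction[OF assms(2), of x] by (simp add: hull_inc)
    then have "(x - w) + (w - v) \<in> ?S" using TA(2) by (intro span_add) (auto intro: span_base)
    then show ?thesis by simp
  qed
  moreover have "direction (A \<union> B) = span ((\<lambda>x. x - v) ` (A \<union> B))"
    using aff assms(1) by (intro direction_eq_span) auto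
  ultimately show "direction (A \<union> B) \<subseteq> ?S"
    by (metis (no_types, lifting) image_subsetI span_minimal subspace_span)
qed

text \<open>The bridge from the product measure in the definition of \<open>aff_lborel\<close> to
  iterated integrals; one coordinate is split off at a time.\<close>

lemma nn_integral_PiM_span_integral:
  fixes Q :: "'a::euclidean_space list"
  assumes "distinct Q" and [measurable]: "f \<in> borel_measurable borel"
  shows "(\<integral>\<^sup>+c. f (v + (\<Sum>b\<in>set Q. c b *\<^sub>R b)) \<partial>(\<Pi>\<^sub>M b\<in>set Q. lborel)) = span_integral Q f v"
  using assms(1)
proof (induction Q arbitrary: v)
  case Nil
  then show ?case by (simp add: PiM_empty nn_integral_count_space_finite)
next
  case (Cons q Q)
  interpret product_sigma_finite "\<lambda>_::'a. lborel :: real measure" ..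
  have "(\<integral>\<^sup>+c. f (v + (\<Sum>b\<in>set (q # Q). c b *\<^sub>R b)) \<partial>(\<Pi>\<^sub>M b\<in>set (q # Q). lborel))
     = (\<integral>\<^sup>+y. \<integral>\<^sup>+x. f (v + (\<Sum>b\<in>insert q (set Q). (x(q := y)) b *\<^sub>R b)) \<partial>(\<Pi>\<^sub>M b\<in>set Q. lborel) \<partial>lborel)"
    unfolding list.set using Cons.prems by (subst product_nn_integral_insert_rev) auto
  also have "\<dots> = (\<integral>\<^sup>+y. \<integral>\<^sup>+x. f ((v + y *\<^sub>R q) + (\<Sum>b\<in>set Q. x b *\<^sub>R b)) \<partial>(\<Pi>\<^sub>M b\<in>set Q. lborel) \<partial>lborel)"
  proof -
    have "(\<Sum>b\<in>insert q (set Q). (x(q := y)) b *\<^sub>R b) = y *\<^sub>R q + (\<Sum>b\<in>set Q. x b *\<^sub>R b)" for x y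
      using Cons.prems by (auto intro!: sum.cong)
    then show ?thesis by (simp add: add.assoc)
  qed
  also have "\<dots> = span_integral (q # Q) f v" using Cons by simp
  finally show ?case .
qed

lemma space_aff_lborel [simp]: "space (aff_lborel F) = UNIV"
  and sets_aff_lborel [simp, measurable_cong]: "sets (aff_lborel F) = sets borel"
  unfolding aff_lborel_def Let_def by simp_all

lemma aff_lborel_cong: "affine hull F = affine hull G \<Longrightarrow> aff_lborel F = aff_lborel G"
  unfolding aff_lborel_def direction_def by simp

lemma orthonormal_list_exists:
  assumes "subspace S"
  obtains Q where "orthonormal_list Q" "span (set Q) = S"
proof -
  obtain B where B: "pairwise orthogonal B" "\<And>x. x \<in> B \<Longrightarrow> norm x = 1" "independent B" "span B = S"
    using orthonormal_basis_subspace[OF assms] by metis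
  obtain Q where "set Q = B" "distinct Q"
    using finite_distinct_list[of B] B(3) independent_imp_finite by blast
  with B that[of Q] show ?thesis by (auto simp: orthonormal_list_def)
qed

text \<open>Both \<open>SOME\<close> choices in \<open>aff_lborel\<close> are harmless: the basis by
  the Gaussian comparison, the base point because it moves within the flat.\<close>

lemma nn_integral_aff_lborel:
  fixes F :: "'a::euclidean_space set"
  assumes v: "v \<in> affine hull F" and Q: "orthonormal_list Q" "span (set Q) = direction F"
    and f [measurable]: "f \<in> borel_measurable borel"
  shows "integral\<^sup>N (aff_lborel F) f = span_integral Q f v"
proof -
  define v' where "v' = (SOME v. v \<in> affine hull F)"
  define B where "B = (SOME B. orthonormal_basis_of (direction F) B)"
  have v': "v' \<in> affine hull F" unfolding v'_def using v by (rule someI)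
  have "orthonormal_basis_of (direction F) (set Q)"
    using Q span_superset[of "set Q"] unfolding orthonormal_basis_of_def orthonormal_list_def by auto
  then have B: "orthonormal_basis_of (direction F) B" unfolding B_def by (rule someI)
  then have "independent B"
    unfolding orthonormal_basis_of_def by (intro pairwise_orthogonal_independent) auto
  then obtain Q' where Q': "set Q' = B" "distinct Q'"
    using finite_distinct_list[of B] independent_imp_finite by blast
  with B have o: "orthonormal_list Q'" "span (set Q') = span (set Q)"
    using Q by (auto simp: orthonormal_list_def orthonormal_basis_of_def)
  have "integral\<^sup>N (aff_lborel F) f = (\<integral>\<^sup>+c. f (v' + (\<Sum>b\<in>set Q'. c b *\<^sub>R b)) \<partial>(\<Pi>\<^sub>M b\<in>set Q'. lborel))"
    unfolding aff_lborel_def Let_def v'_def[symmetric] B_def[symmetric] Q'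
    by (rule nn_integral_distr) auto
  also have "\<dots> = span_integral Q f v'"
    using nn_integral_PiM_span_integral[OF Q'(2) f] span_integral_orthonormal_eq[OF o(1) Q(1) o(2) f] by simp
  also have "\<dots> = span_integral Q f (v + (v' - v))" by simp
  also have "\<dots> = span_integral Q f v"
    using mem_affine_hull_direction[OF v] v' Q(2) by (intro span_integral_translate f) auto
  finally show ?thesis .
qed

lemma emeasure_aff_lborel:
  fixes F :: "'a::euclidean_space set"
  assumes "v \<in> affine hull F" "orthonormal_list Q" "span (set Q) = direction F" "X \<in> sets borel"
  shows "emeasure (aff_lborel F) X = span_integral Q (indicator X) v"
  using nn_integral_aff_lborel[OF assms(1-3), of "indicator X"] assms(4) by simp

text \<open>Balls around a point of the flat exhaust the space and have finite measure, since the
  indicator of the ball of radius n is at most exp(n^2) times the Gaussian.\<close>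

lemma sigma_finite_aff_lborel:
  fixes F :: "'a::euclidean_space set"
  assumes "F \<noteq> {}"
  shows "sigma_finite_measure (aff_lborel F)"
proof -
  obtain v where v: "v \<in> affine hull F" using assms hull_inc by fastforce
  obtain Q where Q: "orthonormal_list Q" "span (set Q) = direction F"
    using orthonormal_list_exists subspace_direction[OF assms] by metis
  have "emeasure (aff_lborel F) (cball v (real n)) \<noteq> \<infinity>" for n
  proof -
    let ?g = "\<lambda>u. ennreal (exp (- (norm (u - v))\<^sup>2))"
    have "emeasure (aff_lborel F) (cball v (real n)) = span_integral Q (indicator (cball v (real n))) v"
      using v Q by (rule emeasure_aff_lborel) auto
    also have "\<dots> \<le> span_integral Q (\<lambda>u. ennreal (exp ((real n)\<^sup>2)) * ?g u) v"
    proof (rule span_integral_mono)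
      fix u
      have "1 \<le> exp ((real n)\<^sup>2) * exp (- (norm (u - v))\<^sup>2)" if "norm (u - v) \<le> real n"
        using that power_mono[OF that, of 2] by (simp add: exp_add[symmetric])
      then show "indicator (cball v (real n)) u \<le> ennreal (exp ((real n)\<^sup>2)) * ?g u"
        by (auto simp: indicator_def dist_norm norm_minus_commute ennreal_mult[symmetric])
    qed
    also have "\<dots> = ennreal (exp ((real n)\<^sup>2)) * gauss_const ^ length Q"
      using span_integral_gauss[OF Q(1), of 0 v] by (subst span_integral_cmult) auto
    also have "\<dots> < \<infinity>"
      using gauss_const_finite by (auto simp: ennreal_mult_less_top power_less_top_ennreal)
    finally show ?thesis by simp
  qed
  moreover have "(\<Union>n. cball v (real n)) = UNIV"
    by (auto simp: real_arch_simple)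
  ultimately show ?thesis
    by (intro sigma_finite_measure.intro exI[of _ "range (\<lambda>n. cball v (real n))"]) auto
qed

lemma AE_affine_hull:
  fixes F :: "'a::euclidean_space set"
  assumes "F \<noteq> {}"
  shows "AE x in aff_lborel F. x \<in> affine hull F"
proof -
  obtain v where v: "v \<in> affine hull F" using assms hull_inc by fastforce
  obtain Q where Q: "orthonormal_list Q" "span (set Q) = direction F"
    using orthonormal_list_exists subspace_direction[OF assms] by metis
  have cl: "closed (affine hull F)" by simp
  have "emeasure (aff_lborel F) (- (affine hull F)) = span_integral Q (indicator (- (affine hull F))) v"
    using v Q by (rule emeasure_aff_lborel) (use cl in auto)
  also have "\<dots> = span_integral Q (\<lambda>_. 0) v"
    using mem_affine_hull_direction[OF v] Q(2) by (intro span_integral_cong_span) simp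
  finally have "emeasure (aff_lborel F) (- (affine hull F)) = 0" by (simp add: span_integral_zero)
  then show ?thesis
    using cl by (intro AE_I[where N = "- (affine hull F)"]) auto
qed

text \<open>If the two hulls meet, they do so in a proper subflat of the hull of \<open>F\<close>.
  That subflat lies in a hyperplane with normal \<open>q\<close> in the direction of
  \<open>F\<close>, and the hyperplane is null by Tonelli.\<close>

lemma AE_not_in_smaller_affine_hull:
  fixes F :: "'a::euclidean_space set"
  assumes "F \<noteq> {}" "aff_dim X < aff_dim F"
  shows "AE x in aff_lborel F. x \<notin> affine hull X"
proof (cases "affine hull X \<inter> affine hull F = {}")
  case True
  then show ?thesis using AE_affine_hull[OF assms(1)] by (auto elim: eventually_mono)
next
  case False
  then obtain v where v: "v \<in> affine hull X" "v \<in> affine hull F" by auto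
  then have "X \<noteq> {}" by auto
  obtain Q where Q: "orthonormal_list Q" "span (set Q) = direction F"
    using orthonormal_list_exists subspace_direction[OF assms(1)] by metis
  have "dim (direction X) < dim (direction F)"
    using assms dim_direction[OF assms(1)] dim_direction[OF \<open>X \<noteq> {}\<close>] by linarith
  then have "span (direction X \<inter> direction F) \<subset> span (direction F)"
    by (metis dim_span dim_subset inf.cobounded1 inf.cobounded2 leD psubsetI span_mono)
  then obtain q where q: "q \<noteq> 0" "q \<in> span (direction F)"
    "\<And>y. y \<in> span (direction X \<inter> direction F) \<Longrightarrow> orthogonal q y"
    using orthogonal_to_subspace_exists_gen by blast
  have "q \<in> span (set Q)" using q(2) subspace_direction[OF assms(1)] Q(2) by (simp add: span_eq_iff[THEN iffD2])
  have "\<exists>q0\<in>set Q. inner q0 q \<noteq> 0"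
  proof (rule ccontr)
    assume "\<not> ?thesis"
    then have "orthogonal q q"
      using orthogonal_to_span[OF \<open>q \<in> span (set Q)\<close>, of q]
      by (auto simp: orthogonal_def inner_commute)
    then show False using q(1) by (simp add: orthogonal_self)
  qed
  then obtain q0 Q1 Q2 where q0: "Q = Q1 @ q0 # Q2" "inner q0 q \<noteq> 0" by (metis split_list)
  define H where "H = {x. inner q (x - v) = 0}"
  have H [measurable]: "H \<in> sets borel"
  proof -
    have "closed H" unfolding H_def by (intro closed_Collect_eq continuous_intros)
    then show ?thesis by simp
  qed
  have "emeasure (aff_lborel F) H = span_integral Q (indicator H) v"
    using v(2) Q H by (rule emeasure_aff_lborel)
  \<comment> \<open>With \<open>q0\<close> innermost, each line along it meets \<open>H\<close> in
    exactly one point, because \<open>q0\<close> is not orthogonal to \<open>q\<close>.\<close>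
  also have "\<dots> = span_integral ((Q1 @ Q2) @ [q0]) (indicator H) v"
    by (rule span_integral_mset) (auto simp: q0)
  also have "\<dots> = span_integral (Q1 @ Q2) (\<lambda>u. \<integral>\<^sup>+c. indicator H (u + c *\<^sub>R q0) \<partial>lborel) v"
    unfolding span_integral_append[of "Q1 @ Q2" "[q0]"] by (rule arg_cong2[where f = "span_integral (Q1 @ Q2)"]) auto
  also have "(\<lambda>u. \<integral>\<^sup>+c. indicator H (u + c *\<^sub>R q0) \<partial>lborel) = (\<lambda>_. 0)"
  proof
    fix u
    have "(\<integral>\<^sup>+c. indicator H (u + c *\<^sub>R q0) \<partial>lborel)
        = (\<integral>\<^sup>+c. indicator {- inner q (u - v) / inner q q0} c \<partial>lborel)"
      using q0(2)
      by (intro nn_integral_cong)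
         (auto simp: indicator_def H_def inner_diff_right inner_add_right inner_commute field_simps)
    then show "(\<integral>\<^sup>+c. indicator H (u + c *\<^sub>R q0) \<partial>lborel) = 0" by simp
  qed
  finally have "emeasure (aff_lborel F) H = 0" by (simp add: span_integral_zero)
  then have "AE x in aff_lborel F. x \<notin> H" by (intro AE_not_in) (auto simp: null_sets_def)
  with AE_affine_hull[OF assms(1)] show ?thesis
  proof eventually_elim
    case (elim x)
    show ?case
    proof
      assume "x \<in> affine hull X"
      then have "x - v \<in> direction X \<inter> direction F"
        using elim mem_affine_hull_direction v by blast
      then show False using q(3)[OF span_base] elim by (auto simp: H_def orthogonal_def)
    qed
  qed
qed

section \<open>Triangular factors as volume factors\<close>

text \<open>The vectors of \<open>Q\<close> are replaced from the last to the first: while all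
  earlier members of \<open>Q\<close> are still present, the off-diagonal part of
  \<open>T ! j\<close> is a shear, so that only the diagonal entry counts.\<close>

lemma span_integral_triangular:
  fixes T Q :: "'a::euclidean_space list"
  assumes "length T = length Q"
    and "\<And>j. j < length Q \<Longrightarrow> r j > 0 \<and> T ! j - r j *\<^sub>R Q ! j \<in> span (set (take j Q))"
    and f: "f \<in> borel_measurable borel"
  shows "span_integral Q f v = ennreal (\<Prod>j<length Q. r j) * span_integral T f v"
  using assms(1,2)
proof (induction Q arbitrary: T v rule: rev_induct)
  case (snoc q Q)
  from snoc.prems(1) obtain T0 t where T: "T = T0 @ [t]" "length T0 = length Q"
    by (metis append_butlast_last_id length_append_singleton length_butlast length_greater_0_conv
        zero_less_Suc diff_Suc_1)
  have IH: "span_integral Q f v = ennreal (\<Prod>j<length Q. r j) * span_integral T0 f v" for v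
  proof (rule snoc.IH[OF T(2)])
    fix j assume "j < length Q"
    then show "r j > 0 \<and> T0 ! j - r j *\<^sub>R Q ! j \<in> span (set (take j Q))"
      using snoc.prems(2)[of j] T by (simp add: nth_append)
  qed
  let ?r = "r (length Q)"
  have r: "?r > 0" "t - ?r *\<^sub>R q \<in> span (set Q)"
    using snoc.prems(2)[of "length Q"] T by (simp_all add: nth_append)
  have [measurable]: "span_integral T0 f \<in> borel_measurable borel" using f by measurable
  have "span_integral (Q @ [q]) f v = span_integral (q # Q) f v"
    by (rule span_integral_mset[OF f]) simp
  also have "\<dots> = ennreal ?r * span_integral (t # Q) f v"
    using span_integral_exchange[OF f r(2), of ?r q v] r(1) by simp
  also have "\<dots> = ennreal ?r * (ennreal (\<Prod>j<length Q. r j) * span_integral (t # T0) f v)"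
    by (simp add: IH nn_integral_cmult)
  also have "span_integral (t # T0) f v = span_integral T f v"
    using T by (intro span_integral_mset[OF f]) simp
  finally show ?case
    using r(1) by (simp add: ennreal_mult' mult_ac)
qed simp

lemma QR_upper_factor_det:
  assumes "QR_upper_factor T R"
  shows "Determinant.det R = (\<Prod>j<length T. R $$ (j, j))" "Determinant.det R > 0"
proof -
  have R: "R \<in> carrier_mat (length T) (length T)" "upper_triangular R" "\<And>i. i < length T \<Longrightarrow> R $$ (i, i) > 0"
    using assms by (auto simp: QR_upper_factor_def Let_def)
  have "Determinant.det R = prod_list (diag_mat R)" using R det_upper_triangular by blast
  also have "\<dots> = (\<Prod>j<length T. R $$ (j, j))"
    using R(1) by (simp add: diag_mat_def prod.list_conv_set_nth atLeast0LessThan)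
  finally show 1: "Determinant.det R = (\<Prod>j<length T. R $$ (j, j))" .
  show "Determinant.det R > 0" unfolding 1 using R(3) by (intro prod_pos) auto
qed

text \<open>The geometric meaning of \<open>Determinant.det R\<close>: it is the volume of the
  parallelepiped spanned by \<open>T\<close>, hence the Jacobian of the coordinates with respect to
  \<open>T\<close>.\<close>

lemma nn_integral_aff_lborel_QR:
  fixes F :: "'a::euclidean_space set"
  assumes QR: "QR_upper_factor T R" and v: "v \<in> affine hull F" and T: "span (set T) = direction F"
    and f: "f \<in> borel_measurable borel"
  shows "integral\<^sup>N (aff_lborel F) f = ennreal (Determinant.det R) * span_integral T f v"
proof -
  let ?m = "length T"
  obtain Q where Q: "length Q = ?m"
      "\<And>i j. i < ?m \<Longrightarrow> j < ?m \<Longrightarrow> inner (Q ! i) (Q ! j) = (if i = j then 1 else 0)"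
      "\<And>j. j < ?m \<Longrightarrow> T ! j = (\<Sum>i<?m. R $$ (i, j) *\<^sub>R Q ! i)"
    using QR by (auto simp: QR_upper_factor_def Let_def)
  have R: "R \<in> carrier_mat ?m ?m" "upper_triangular R" "\<And>i. i < ?m \<Longrightarrow> R $$ (i, i) > 0"
    using QR by (auto simp: QR_upper_factor_def Let_def)
  have dQ: "distinct Q"
    unfolding distinct_conv_nth using Q(1,2) by (metis zero_neq_one)
  have "orthonormal_list Q"
    unfolding orthonormal_list_def pairwise_def orthogonal_def
    using dQ Q(1,2) by (auto simp: in_set_conv_nth norm_eq_1)
  have step: "T ! j - R $$ (j, j) *\<^sub>R Q ! j \<in> span (set (take j Q))" if j: "j < ?m" for j
  proof -
    have "T ! j = (\<Sum>i<?m. R $$ (i, j) *\<^sub>R Q ! i)" using Q(3) j by simp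
    \<comment> \<open>Upper triangularity: the entries below the diagonal of column j
      vanish.\<close>
    also have "\<dots> = (\<Sum>i<Suc j. R $$ (i, j) *\<^sub>R Q ! i)"
      using j R(1,2) by (intro sum.mono_neutral_right) auto
    finally have "T ! j - R $$ (j, j) *\<^sub>R Q ! j = (\<Sum>i<j. R $$ (i, j) *\<^sub>R Q ! i)" by simp
    also have "\<dots> \<in> span (set (take j Q))"
      using j Q(1) by (intro span_sum span_scale span_base) (auto simp: in_set_conv_nth)
    finally show ?thesis .
  qed
  have sub: "set T \<subseteq> span (set Q)"
  proof
    fix t assume "t \<in> set T"
    then obtain j where "j < ?m" "t = T ! j" by (metis in_set_conv_nth)
    moreover have "(\<Sum>i<?m. R $$ (i, j) *\<^sub>R Q ! i) \<in> span (set Q)"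
      using Q(1) by (intro span_sum span_scale span_base) auto
    ultimately show "t \<in> span (set Q)" using Q(3) by simp
  qed
  \<comment> \<open>The orthonormal vectors are recovered successively by solving the triangular
    system, dividing by its positive diagonal.\<close>
  have Qi: "set (take j Q) \<subseteq> span (set T)" if "j \<le> ?m" for j
    using that
  proof (induction j)
    case (Suc j)
    then have IH: "set (take j Q) \<subseteq> span (set T)" and j: "j < ?m" by auto
    have "T ! j - R $$ (j, j) *\<^sub>R Q ! j \<in> span (set T)"
      using step[OF j] span_mono[OF IH] by (auto simp: span_span)
    from span_diff[OF span_base[of "T ! j"] this]
    have "R $$ (j, j) *\<^sub>R Q ! j \<in> span (set T)" using j by simp
    then have "inverse (R $$ (j, j)) *\<^sub>R (R $$ (j, j) *\<^sub>R Q ! j) \<in> span (set T)"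
      by (rule span_scale)
    then have "Q ! j \<in> span (set T)" using R(3)[OF j] by simp
    then show ?case using IH j Q(1) by (simp add: take_Suc_conv_app_nth)
  qed simp
  then have "set Q \<subseteq> span (set T)" using Q(1) by (metis order_refl take_all)
  with sub have "span (set Q) = direction F"
    using T by (metis span_eq)
  then have "integral\<^sup>N (aff_lborel F) f = span_integral Q f v"
    using nn_integral_aff_lborel[OF v \<open>orthonormal_list Q\<close> _ f] by blast
  also have "\<dots> = ennreal (Determinant.det R) * span_integral T f v"
    unfolding QR_upper_factor_det(1)[OF QR] Q(1)[symmetric]
    using step R(3) Q(1) by (intro span_integral_triangular f) auto
  finally show ?thesis .
qed

text \<open>The condition on prefixes makes the factor of the QR factorization upper triangular, and
  the sign condition makes its diagonal positive. The next vector is the normalized part of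
  \<open>t\<close> orthogonal to the span so far.\<close>

lemma gram_schmidt_list:
  fixes T :: "'a::euclidean_space list"
  assumes "distinct T" "independent (set T)"
  shows "\<exists>Q. orthonormal_list Q \<and> length Q = length T \<and> span (set Q) = span (set T) \<and>
    (\<forall>j<length T. T ! j \<in> span (set (take (Suc j) Q)) \<and> inner (T ! j) (Q ! j) > 0)"
  using assms
proof (induction T rule: rev_induct)
  case Nil
  show ?case by (intro exI[of _ "[]"]) (simp add: orthonormal_list_def)
next
  case (snoc t T)
  have ind: "independent (set T)" "t \<notin> span (set T)"
    using snoc.prems by (auto simp: independent_insert)
  with snoc obtain Q where Q: "orthonormal_list Q" "length Q = length T" "span (set Q) = span (set T)"
    "\<And>j. j < length T \<Longrightarrow> T ! j \<in> span (set (take (Suc j) Q)) \<and> inner (T ! j) (Q ! j) > 0"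
    by auto
  obtain y z where yz: "y \<in> span (set T)" "\<And>w. w \<in> span (set T) \<Longrightarrow> orthogonal z w" "t = y + z"
    using orthogonal_subspace_decomp_exists by metis
  have "z \<noteq> 0" using yz ind(2) by auto
  define q where "q = z /\<^sub>R norm z"
  have q: "norm q = 1" "z = norm z *\<^sub>R q" "q \<in> span {z}"
    using \<open>z \<noteq> 0\<close> by (auto simp: q_def intro: span_scale span_base)
  have orth: "inner q w = 0" if "w \<in> span (set T)" for w
    using yz(2)[OF that] by (simp add: q_def orthogonal_def)
  have "q \<notin> set Q" using orth[of q] q(1) Q(3) span_base[of q "set Q"] by (auto simp: norm_eq_1)
  then have oq: "orthonormal_list (Q @ [q])"
    using Q(1,3) q(1) orth span_base[of _ "set Q"]
    by (auto simp: orthonormal_list_def pairwise_insert orthogonal_def inner_commute)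
  have t: "t \<in> span (insert q (set Q))"
    unfolding span_breakdown_eq[of t q] using yz q(2) Q(3)
    by (intro exI[of _ "norm z"]) (metis add_diff_cancel)
  have "q \<in> span (insert t (set T))"
    unfolding q_def using yz span_mono[of "set T" "insert t (set T)"]
    by (intro span_scale) (metis add_diff_cancel_left' insertI1 span_base span_diff subset_insertI subsetD)
  then have "span (insert q (set Q)) = span (insert t (set T))"
    using t Q(3) span_superset[of "set T"] span_superset[of "set Q"]
      span_mono[of "set T" "insert t (set T)"] span_mono[of "set Q" "insert q (set Q)"]
    by (intro span_eq[THEN iffD2]) (metis insert_subset order_trans subset_insertI)
  moreover have "inner t q = norm z"
    using yz(1,3) orth[OF yz(1)] q by (metis inner_add_left inner_commute inner_scaleR_left add_0 mult.right_neutral norm_eq_1)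
  ultimately show ?case
    using Q oq t \<open>z \<noteq> 0\<close>
    by (intro exI[of _ "Q @ [q]"]) (auto simp: nth_append less_Suc_eq)
qed

lemma QR_upper_factor_exists:
  fixes T :: "'a::euclidean_space list"
  assumes "distinct T" "independent (set T)"
  shows "\<exists>R. QR_upper_factor T R"
proof -
  let ?m = "length T"
  obtain Q where Q: "orthonormal_list Q" "length Q = ?m" "span (set Q) = span (set T)"
    "\<And>j. j < ?m \<Longrightarrow> T ! j \<in> span (set (take (Suc j) Q)) \<and> inner (T ! j) (Q ! j) > 0"
    using gram_schmidt_list[OF assms] by blast
  have qq: "inner (Q ! i) (Q ! j) = (if i = j then 1 else 0)" if "i < ?m" "j < ?m" for i j
    using Q(1,2) that nth_eq_iff_index_eq[of Q i j]
    by (auto simp: orthonormal_list_def pairwise_def orthogonal_def norm_eq_1[symmetric])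
  \<comment> \<open>The entries are the coordinates of the columns in the orthonormal basis; those
    below the diagonal vanish because \<open>T ! j\<close> lies in the span of the first j + 1
    vectors of \<open>Q\<close>.\<close>
  define R where "R = Matrix.mat ?m ?m (\<lambda>(i, j). inner (T ! j) (Q ! i))"
  have "inner (T ! j) (Q ! i) = 0" if "j < i" "i < ?m" for i j
  proof -
    have "orthogonal (Q ! i) (T ! j)"
    proof (rule orthogonal_to_span)
      show "T ! j \<in> span (set (take (Suc j) Q))" using Q(4) that by simp
      show "orthogonal (Q ! i) y" if "y \<in> set (take (Suc j) Q)" for y
        using that \<open>j < i\<close> \<open>i < ?m\<close> qq by (auto simp: in_set_conv_nth orthogonal_def)
    qed
    then show ?thesis by (simp add: orthogonal_def inner_commute)
  qed
  then have "upper_triangular R" unfolding R_def by auto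
  moreover have "T ! j = (\<Sum>i<?m. R $$ (i, j) *\<^sub>R Q ! i)" if j: "j < ?m" for j
  proof -
    have "T ! j \<in> span (set Q)" using j Q(3) by (simp add: span_base)
    then have "T ! j = (\<Sum>q\<in>set Q. inner (T ! j) q *\<^sub>R q)"
      using Q(1) orthonormal_basis_expand[of "set Q" "T ! j"] by (simp add: orthonormal_list_def)
    also have "\<dots> = (\<Sum>i<?m. inner (T ! j) (Q ! i) *\<^sub>R Q ! i)"
      using Q(1,2) by (intro sum.reindex_bij_betw[symmetric] bij_betw_nth)
        (auto simp: orthonormal_list_def)
    finally show ?thesis using j by (simp add: R_def)
  qed
  ultimately show ?thesis
    using Q(2,4) qq unfolding QR_upper_factor_def Let_def
    by (intro exI[of _ R]) (auto simp: R_def intro!: exI[of _ Q])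
qed

section \<open>Joins of skew sets\<close>

lemma affine_hull_Times: "affine hull (X \<times> Y) = (affine hull X) \<times> (affine hull Y)"
proof
  show "affine hull (X \<times> Y) \<subseteq> (affine hull X) \<times> (affine hull Y)"
  proof (rule hull_minimal)
    show "X \<times> Y \<subseteq> (affine hull X) \<times> (affine hull Y)" by (auto intro: hull_inc)
    show "affine ((affine hull X) \<times> (affine hull Y))"
      using affine_affine_hull[of X] affine_affine_hull[of Y] by (auto simp: affine_def)
  qed
  let ?H = "affine hull (X \<times> Y)"
  have aff: "u *\<^sub>R p + v *\<^sub>R q \<in> ?H" if "p \<in> ?H" "q \<in> ?H" "u + v = 1" for u v p q
    using that affine_affine_hull[of "X \<times> Y"] unfolding affine_def by blast
  \<comment> \<open>The factors are enlarged one after the other: first \<open>X\<close> over a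
    fixed point of \<open>Y\<close>, then \<open>Y\<close> over a point already in the hull of
    \<open>X\<close>.\<close>
  have 1: "affine hull X \<subseteq> {x. (x, y) \<in> ?H}" if "y \<in> Y" for y
  proof (rule hull_minimal)
    show "X \<subseteq> {x. (x, y) \<in> ?H}" using that by (auto intro: hull_inc)
    show "affine {x. (x, y) \<in> ?H}"
      using aff[of "(_, y)" "(_, y)"]
      by (auto simp: affine_def[of "Collect _"] scaleR_left_distrib[symmetric])
  qed
  have 2: "affine hull Y \<subseteq> {y. (x, y) \<in> ?H}" if "x \<in> affine hull X" for x
  proof (rule hull_minimal)
    show "Y \<subseteq> {y. (x, y) \<in> ?H}" using that 1 by auto
    show "affine {y. (x, y) \<in> ?H}"
      using aff[of "(x, _)" "(x, _)"]
      by (auto simp: affine_def[of "Collect _"] scaleR_left_distrib[symmetric])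
  qed
  show "(affine hull X) \<times> (affine hull Y) \<subseteq> ?H" using 2 by auto
qed

lemma direction_Times: "direction (X \<times> Y) = direction X \<times> direction Y"
  unfolding direction_def affine_hull_Times by auto

lemma aff_dim_Times:
  fixes X :: "'a::euclidean_space set" and Y :: "'b::euclidean_space set"
  assumes "X \<noteq> {}" "Y \<noteq> {}"
  shows "aff_dim (X \<times> Y) = aff_dim X + aff_dim Y"
  using assms dim_direction[of "X \<times> Y"] dim_direction[of X] dim_direction[of Y]
    dim_Times[OF subspace_direction subspace_direction, of X Y]
  by (simp add: direction_Times)

lemma span_integral_fst:
  "span_integral (map (\<lambda>q. (q, 0)) Q) f (x, y) = span_integral Q (\<lambda>x. f (x, y)) x"
  by (induction Q arbitrary: x) auto

lemma span_integral_snd: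
  "span_integral (map (\<lambda>q. (0, q)) Q) f (x, y) = span_integral Q (\<lambda>y. f (x, y)) y"
  by (induction Q arbitrary: y) auto

text \<open>Orthonormal bases of the two factors, embedded in the coordinate subspaces, form one of
  the product. Both measures therefore agree on rectangles, and \<sigma>-finiteness gives
  uniqueness.\<close>

lemma aff_lborel_Times:
  fixes X :: "'a::euclidean_space set" and Y :: "'b::euclidean_space set"
  assumes ne: "X \<noteq> {}" "Y \<noteq> {}"
  shows "aff_lborel X \<Otimes>\<^sub>M aff_lborel Y = aff_lborel (X \<times> Y)"
proof (rule pair_measure_eqI)
  show "sigma_finite_measure (aff_lborel X)" "sigma_finite_measure (aff_lborel Y)"
    using ne by (simp_all add: sigma_finite_aff_lborel)
  show "sets (aff_lborel X \<Otimes>\<^sub>M aff_lborel Y) = sets (aff_lborel (X \<times> Y))"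
    unfolding sets_pair_measure_cong[OF sets_aff_lborel sets_aff_lborel] borel_prod by simp
  fix A B assume "A \<in> sets (aff_lborel X)" "B \<in> sets (aff_lborel Y)"
  then have [measurable]: "A \<in> sets borel" "B \<in> sets borel" by simp_all
  have [measurable]: "A \<times> B \<in> sets borel"
    by (subst borel_prod[symmetric]) measurable
  obtain v w where v: "v \<in> affine hull X" and w: "w \<in> affine hull Y"
    using ne by (meson all_not_in_conv hull_inc)
  obtain Q where Q: "orthonormal_list Q" "span (set Q) = direction X"
    using orthonormal_list_exists subspace_direction[OF ne(1)] by metis
  obtain Q' where Q': "orthonormal_list Q'" "span (set Q') = direction Y"
    using orthonormal_list_exists subspace_direction[OF ne(2)] by metis
  let ?L = "map (\<lambda>q. (q, 0)) Q @ map (\<lambda>q. (0, q)) Q' :: ('a \<times> 'b) list"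
  \<comment> \<open>A nonzero \<open>q\<close> keeps the embedded vectors (q, 0) and (0, q')
    distinct.\<close>
  have "norm q \<noteq> 0" if "q \<in> set Q" for q using that Q(1) by (auto simp: orthonormal_list_def)
  then have o: "orthonormal_list ?L"
    using Q(1) Q'(1)
    by (auto simp: orthonormal_list_def distinct_map inj_on_def pairwise_def orthogonal_def norm_Pair)
       blast+
  have lin: "linear (\<lambda>q. (q, 0) :: 'a \<times> 'b)" "linear (\<lambda>q. (0, q) :: 'a \<times> 'b)"
    by (auto intro!: linearI)
  have "span (set ?L) = direction (X \<times> Y)"
    unfolding direction_Times Q(2)[symmetric] Q'(2)[symmetric] set_append set_map span_Un
      span_linear_image[OF lin(1)] span_linear_image[OF lin(2)] by force
  then have "emeasure (aff_lborel (X \<times> Y)) (A \<times> B) = span_integral ?L (indicator (A \<times> B)) (v, w)"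
    using v w o by (intro emeasure_aff_lborel) (auto simp: affine_hull_Times)
  also have "\<dots> = span_integral Q (\<lambda>x. span_integral Q' (\<lambda>y. indicator A x * indicator B y) w) v"
    unfolding span_integral_append span_integral_fst span_integral_snd
    by (simp add: indicator_times)
  also have "\<dots> = span_integral Q (\<lambda>x. span_integral Q' (indicator B) w * indicator A x) v"
    by (subst span_integral_cmult) (auto simp: mult.commute)
  also have "\<dots> = emeasure (aff_lborel X) A * emeasure (aff_lborel Y) B"
    using emeasure_aff_lborel[OF v Q] emeasure_aff_lborel[OF w Q']
    by (subst span_integral_cmult) (auto simp: mult.commute)
  finally show "emeasure (aff_lborel X) A * emeasure (aff_lborel Y) B
      = emeasure (aff_lborel (X \<times> Y)) (A \<times> B)" by simp
qed

lemma basis_list_of_exists: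
  fixes S :: "'a::euclidean_space set"
  assumes "subspace S"
  obtains T where "basis_list_of S T"
  using orthonormal_list_exists[OF assms] orthonormal_list_independent
  by (metis basis_list_of_def orthonormal_list_def)

lemma length_basis_list_of:
  assumes "basis_list_of (direction F) T" "F \<noteq> {}"
  shows "int (length T) = aff_dim F"
  using assms dim_direction[OF assms(2)] length_eq_dim unfolding basis_list_of_def by metis

section \<open>Skew pairs of sets and the factor \<delta>\<close>

text \<open>The largest possible dimension of a union. For nonempty sets this says that the hulls
  are disjoint and the directions meet only in 0. Since \<open>aff_dim {} = -1\<close>, the empty
  set is skew to everything, which provides the start of the tiling induction.\<close>

definition affinely_skew :: "'a::euclidean_space set \<Rightarrow> 'a set \<Rightarrow> bool" where
  "affinely_skew A B \<longleftrightarrow> aff_dim (A \<union> B) = aff_dim A + aff_dim B + 1"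

lemma aff_dim_Un_le:
  fixes A B :: "'a::euclidean_space set"
  shows "aff_dim (A \<union> B) \<le> aff_dim A + aff_dim B + 1"
proof (cases "A = {} \<or> B = {}")
  case False
  then have ne: "A \<noteq> {}" "B \<noteq> {}" "A \<union> B \<noteq> {}" by auto
  obtain v w where v: "v \<in> affine hull A" and w: "w \<in> affine hull B"
    using ne by (meson all_not_in_conv hull_inc)
  obtain TA where TA: "basis_list_of (direction A) TA"
    using basis_list_of_exists subspace_direction[OF ne(1)] by metis
  obtain TB where TB: "basis_list_of (direction B) TB"
    using basis_list_of_exists subspace_direction[OF ne(2)] by metis
  have "span (set (TA @ TB @ [w - v])) = direction (A \<union> B)"
    using direction_Un[OF v w] TA TB by (auto simp: basis_list_of_def)
  then have "dim (direction (A \<union> B)) \<le> card (set (TA @ TB @ [w - v]))"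
    by (metis List.finite_set dim_le_card order_refl)
  then have "dim (direction (A \<union> B)) \<le> length TA + length TB + 1"
    using card_length[of "TA @ TB @ [w - v]"] by simp
  then show ?thesis
    using dim_direction[OF ne(3)] length_basis_list_of[OF TA ne(1)] length_basis_list_of[OF TB ne(2)]
    by linarith
qed auto

text \<open>The list spans the direction of the union and, by skewness, has just as many members as
  that direction has dimensions.\<close>

lemma affinely_skew_independent:
  fixes A B :: "'a::euclidean_space set"
  assumes skew: "affinely_skew A B" and v: "v \<in> affine hull A" and w: "w \<in> affine hull B"
    and TA: "basis_list_of (direction A) TA" and TB: "basis_list_of (direction B) TB"
  shows "distinct (TA @ TB @ [w - v])" "independent (set (TA @ TB @ [w - v]))"
proof -
  let ?L = "TA @ TB @ [w - v]"
  have ne: "A \<noteq> {}" "B \<noteq> {}" "A \<union> B \<noteq> {}" using v w by auto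
  have s: "span (set ?L) = direction (A \<union> B)"
    using direction_Un[OF v w] TA TB by (auto simp: basis_list_of_def)
  have "dim (direction (A \<union> B)) = length ?L"
    using dim_direction[OF ne(3)] length_basis_list_of[OF TA ne(1)] length_basis_list_of[OF TB ne(2)]
      skew unfolding affinely_skew_def by simp
  moreover have "dim (direction (A \<union> B)) \<le> card (set ?L)"
    using s by (metis List.finite_set dim_le_card order_refl)
  ultimately have c: "card (set ?L) = length ?L" "card (set ?L) \<le> dim (direction (A \<union> B))"
    using card_length[of ?L] by linarith+
  show "distinct ?L" using c(1) by (rule card_distinct)
  show "independent (set ?L)"
    using s c(2) span_superset[of "set ?L"] by (intro card_le_dim_spanning[of _ "direction (A \<union> B)"]) auto
qed

text \<open>The vector joining the hulls lies outside the sum of the directions, which isolates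
  \<open>t\<close>; the rest follows as the directions meet only in 0. At \<open>t = 1\<close>
  nothing is seen of \<open>a\<close>, at \<open>t = 0\<close> nothing of \<open>b\<close>.\<close>

lemma affinely_skew_unique:
  fixes A B :: "'a::euclidean_space set"
  assumes skew: "affinely_skew A B" and a: "a \<in> affine hull A" "a' \<in> affine hull A"
    and b: "b \<in> affine hull B" "b' \<in> affine hull B"
    and eq: "(1 - t) *\<^sub>R a + t *\<^sub>R b = (1 - t') *\<^sub>R a' + t' *\<^sub>R b'"
  shows "t = t'" "t \<noteq> 1 \<Longrightarrow> a = a'" "t \<noteq> 0 \<Longrightarrow> b = b'"
proof -
  have ne: "A \<noteq> {}" "B \<noteq> {}" using a b by auto
  obtain TA where TA: "basis_list_of (direction A) TA"
    using basis_list_of_exists subspace_direction[OF ne(1)] by metis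
  obtain TB where TB: "basis_list_of (direction B) TB"
    using basis_list_of_exists subspace_direction[OF ne(2)] by metis
  note ind = affinely_skew_independent[OF skew a(2) b(2) TA TB]
  let ?d = "b' - a'" let ?x = "(1 - t) *\<^sub>R (a - a')" let ?y = "t *\<^sub>R (b - b')"
  have "a - a' \<in> span (set TA)" "b - b' \<in> span (set TB)"
    using TA TB mem_affine_hull_direction[OF a(2), of a] mem_affine_hull_direction[OF b(2), of b] a b
    by (simp_all add: basis_list_of_def)
  then have x: "?x \<in> span (set TA)" and y: "?y \<in> span (set TB)" by (simp_all add: span_scale)
  have sum: "?x + ?y + (t - t') *\<^sub>R ?d = 0" using eq by (simp add: algebra_simps)
  have d: "?d \<notin> span (set TA \<union> set TB)"
    using ind by (auto simp: independent_insert)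
  show t: "t = t'"
  proof (rule ccontr)
    assume "t \<noteq> t'"
    have "(t - t') *\<^sub>R ?d = - (?x + ?y)" using sum by (metis add.commute eq_neg_iff_add_eq_0)
    then have "?d = inverse (t - t') *\<^sub>R (- (?x + ?y))"
      using \<open>t \<noteq> t'\<close> by (metis eq_iff_diff_eq_0 left_inverse scaleR_one scaleR_scaleR)
    also have "\<dots> \<in> span (set TA \<union> set TB)"
    proof -
      have "?x \<in> span (set TA \<union> set TB)" "?y \<in> span (set TA \<union> set TB)"
        using x y span_mono[of "set TA" "set TA \<union> set TB"] span_mono[of "set TB" "set TA \<union> set TB"]
        by auto
      then show ?thesis by (metis span_add span_neg span_scale)
    qed
    finally show False using d by simp
  qed
  have indAB: "independent (set TA \<union> set TB)" "set TA \<inter> set TB = {}"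
    using ind by (auto simp: independent_insert split: if_splits intro: independent_mono)
  have "dim {x + y |x y. x \<in> span (set TA) \<and> y \<in> span (set TB)}
        + dim (span (set TA) \<inter> span (set TB)) = dim (span (set TA)) + dim (span (set TB))"
    by (rule dim_sums_Int) auto
  moreover have "dim (span (set TA \<union> set TB)) = card (set TA) + card (set TB)"
    using indAB by (metis List.finite_set card_Un_disjoint dim_span_eq_card_independent)
  moreover have "dim (span (set TA)) = card (set TA)" "dim (span (set TB)) = card (set TB)"
    using TA TB dim_span_eq_card_independent unfolding basis_list_of_def by blast+
  ultimately have "dim (span (set TA) \<inter> span (set TB)) = 0"
    unfolding span_Un by linarith
  then have int: "span (set TA) \<inter> span (set TB) \<subseteq> {0}" by simp
  have xy: "?x = - ?y" using sum t by (simp add: eq_neg_iff_add_eq_0)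
  then have "?x \<in> span (set TB)" using y span_neg by metis
  then have "?x = 0" using x int by blast
  with xy show "t \<noteq> 1 \<Longrightarrow> a = a'" "t \<noteq> 0 \<Longrightarrow> b = b'" by auto
qed

text \<open>Existence of QR factors makes the \<open>SOME\<close> in \<open>delta\<close>
  meaningful. The join formula is then derived with the bases and points that this choice stands
  for.\<close>

lemma delta_witness:
  fixes A B :: "'a::euclidean_space set"
  assumes skew: "affinely_skew A B" and ne: "A \<noteq> {}" "B \<noteq> {}"
  shows "\<exists>TA TB v w R RA RB.
        basis_list_of (direction A) TA \<and> basis_list_of (direction B) TB \<and>
        v \<in> affine hull A \<and> w \<in> affine hull B \<and>
        QR_upper_factor (TA @ TB @ [w - v]) R \<and> QR_upper_factor TA RA \<and> QR_upper_factor TB RB \<and>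
        delta A B = Determinant.det R / (Determinant.det RA * Determinant.det RB)"
proof -
  obtain v w where v: "v \<in> affine hull A" and w: "w \<in> affine hull B"
    using ne by (meson all_not_in_conv hull_inc)
  obtain TA where TA: "basis_list_of (direction A) TA"
    using basis_list_of_exists subspace_direction[OF ne(1)] by metis
  obtain TB where TB: "basis_list_of (direction B) TB"
    using basis_list_of_exists subspace_direction[OF ne(2)] by metis
  obtain R where "QR_upper_factor (TA @ TB @ [w - v]) R"
    using QR_upper_factor_exists affinely_skew_independent[OF skew v w TA TB] by metis
  moreover obtain RA RB where "QR_upper_factor TA RA" "QR_upper_factor TB RB"
    using QR_upper_factor_exists TA TB unfolding basis_list_of_def by metis
  ultimately have "\<exists>\<delta> TA TB v w R RA RB.
        basis_list_of (direction A) TA \<and> basis_list_of (direction B) TB \<and>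
        v \<in> affine hull A \<and> w \<in> affine hull B \<and>
        QR_upper_factor (TA @ TB @ [w - v]) R \<and> QR_upper_factor TA RA \<and> QR_upper_factor TB RB \<and>
        \<delta> = Determinant.det R / (Determinant.det RA * Determinant.det RB)"
    using v w TA TB by blast
  then show ?thesis unfolding delta_def by (rule someI_ex)
qed

lemma delta_pos:
  fixes A B :: "'a::euclidean_space set"
  assumes "affinely_skew A B" "A \<noteq> {}" "B \<noteq> {}"
  shows "delta A B > 0"
  using delta_witness[OF assms] by (auto dest!: QR_upper_factor_det(2))

text \<open>At coordinate \<open>t\<close> along w - v the base point is (1 - t) v + t w, and
  rescaling the integrations along \<open>TA\<close> and \<open>TB\<close> by 1 - t and t costs one
  factor per vector. The formula covers the whole affine hull, so \<open>t\<close> runs over the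
  whole line and absolute values appear.\<close>

lemma nn_integral_join:
  fixes A B :: "'a::euclidean_space set"
  assumes skew: "affinely_skew A B" and ne: "A \<noteq> {}" "B \<noteq> {}"
    and f [measurable]: "f \<in> borel_measurable borel"
  shows "integral\<^sup>N (aff_lborel (A \<union> B)) f =
    (\<integral>\<^sup>+t. ennreal (delta A B * (\<bar>1 - t\<bar> ^ nat (aff_dim A) * \<bar>t\<bar> ^ nat (aff_dim B))) *
       (\<integral>\<^sup>+a. \<integral>\<^sup>+b. f ((1 - t) *\<^sub>R a + t *\<^sub>R b) \<partial>aff_lborel B \<partial>aff_lborel A) \<partial>lborel)"
proof -
  obtain TA TB v w R RA RB where
    TA: "basis_list_of (direction A) TA" and TB: "basis_list_of (direction B) TB" and
    v: "v \<in> affine hull A" and w: "w \<in> affine hull B" and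
    R: "QR_upper_factor (TA @ TB @ [w - v]) R" and RA: "QR_upper_factor TA RA" and
    RB: "QR_upper_factor TB RB" and
    \<delta>: "delta A B = Determinant.det R / (Determinant.det RA * Determinant.det RB)"
    using delta_witness[OF skew ne] by blast
  have len: "length TA = nat (aff_dim A)" "length TB = nat (aff_dim B)"
    using length_basis_list_of[OF TA ne(1)] length_basis_list_of[OF TB ne(2)] by simp_all
  have pos: "Determinant.det R > 0" "Determinant.det RA > 0" "Determinant.det RB > 0"
    using R RA RB QR_upper_factor_det(2) by blast+
  interpret B: sigma_finite_measure "aff_lborel B" using ne(2) by (rule sigma_finite_aff_lborel)
  have span: "span (set (TA @ TB @ [w - v])) = direction (A \<union> B)"
    using direction_Un[OF v w] TA TB by (auto simp: basis_list_of_def)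
  have vAB: "v \<in> affine hull (A \<union> B)" using v hull_mono[of A "A \<union> B"] by blast
  have [measurable]: "span_integral TB f \<in> borel_measurable borel" by measurable
  have "integral\<^sup>N (aff_lborel (A \<union> B)) f
      = ennreal (Determinant.det R) * span_integral (TA @ TB @ [w - v]) f v"
    by (rule nn_integral_aff_lborel_QR[OF R vAB span f])
  also have "span_integral (TA @ TB @ [w - v]) f v = span_integral ((w - v) # TA @ TB) f v"
    by (rule span_integral_mset) auto
  also have "ennreal (Determinant.det R) * \<dots> = (\<integral>\<^sup>+t. ennreal (Determinant.det R) *
      span_integral TA (span_integral TB f) (v + t *\<^sub>R (w - v)) \<partial>lborel)"
    by (simp add: span_integral_append nn_integral_cmult)
  also have "\<dots> = (\<integral>\<^sup>+t. ennreal (delta A B * (\<bar>1 - t\<bar> ^ nat (aff_dim A) * \<bar>t\<bar> ^ nat (aff_dim B))) *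
       (\<integral>\<^sup>+a. \<integral>\<^sup>+b. f ((1 - t) *\<^sub>R a + t *\<^sub>R b) \<partial>aff_lborel B \<partial>aff_lborel A) \<partial>lborel)"
  proof (rule nn_integral_cong_AE)
    \<comment> \<open>The rescaling divides by \<open>t\<close> and \<open>1 - t\<close>; the two
      exceptional values form a null set.\<close>
    have "AE t in lborel. t \<noteq> (0::real)" "AE t in lborel. t \<noteq> (1::real)" by (simp_all add: AE_lborel_singleton)
    then show "AE t in lborel. ennreal (Determinant.det R) *
        span_integral TA (span_integral TB f) (v + t *\<^sub>R (w - v)) =
        ennreal (delta A B * (\<bar>1 - t\<bar> ^ nat (aff_dim A) * \<bar>t\<bar> ^ nat (aff_dim B))) *
       (\<integral>\<^sup>+a. \<integral>\<^sup>+b. f ((1 - t) *\<^sub>R a + t *\<^sub>R b) \<partial>aff_lborel B \<partial>aff_lborel A)"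
    proof eventually_elim
      case (elim t)
      have b: "span_integral TB f ((1 - t) *\<^sub>R a + t *\<^sub>R w) = ennreal (\<bar>t\<bar> ^ length TB) *
          span_integral TB (\<lambda>b. f ((1 - t) *\<^sub>R a + t *\<^sub>R b)) w" for a
      proof -
        have "span_integral TB f ((1 - t) *\<^sub>R a + t *\<^sub>R w)
            = span_integral TB (\<lambda>u. f (u + (1 - t) *\<^sub>R a)) (t *\<^sub>R w)"
          by (simp add: span_integral_shift add.commute)
        also have "\<dots> = ennreal (\<bar>t\<bar> ^ length TB) * span_integral TB (\<lambda>u. f (t *\<^sub>R u + (1 - t) *\<^sub>R a)) w"
          using elim by (intro span_integral_scale) auto
        finally show ?thesis by (simp add: add.commute)
      qed
      have "span_integral TA (span_integral TB f) (v + t *\<^sub>R (w - v))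
          = span_integral TA (span_integral TB f) ((1 - t) *\<^sub>R v + t *\<^sub>R w)"
        by (simp add: algebra_simps)
      also have "\<dots> = span_integral TA (\<lambda>u. span_integral TB f (u + t *\<^sub>R w)) ((1 - t) *\<^sub>R v)"
        by (simp add: span_integral_shift)
      also have "\<dots> = ennreal (\<bar>1 - t\<bar> ^ length TA) *
          span_integral TA (\<lambda>a. span_integral TB f ((1 - t) *\<^sub>R a + t *\<^sub>R w)) v"
        using elim by (intro span_integral_scale) auto
      finally have 1: "span_integral TA (span_integral TB f) (v + t *\<^sub>R (w - v)) =
        ennreal (\<bar>1 - t\<bar> ^ length TA) *
          span_integral TA (\<lambda>a. span_integral TB f ((1 - t) *\<^sub>R a + t *\<^sub>R w)) v" .
      have 2: "(\<integral>\<^sup>+b. f ((1 - t) *\<^sub>R a + t *\<^sub>R b) \<partial>aff_lborel B)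
          = ennreal (Determinant.det RB) * span_integral TB (\<lambda>b. f ((1 - t) *\<^sub>R a + t *\<^sub>R b)) w" for a
        using TB by (intro nn_integral_aff_lborel_QR[OF RB w]) (auto simp: basis_list_of_def)
      have 3: "ennreal (Determinant.det RB) * span_integral TB f ((1 - t) *\<^sub>R a + t *\<^sub>R w)
          = ennreal (\<bar>t\<bar> ^ length TB) * (\<integral>\<^sup>+b. f ((1 - t) *\<^sub>R a + t *\<^sub>R b) \<partial>aff_lborel B)" for a
        unfolding 2 b by (simp add: mult_ac)
      have "(\<lambda>a. \<integral>\<^sup>+b. f ((1 - t) *\<^sub>R a + t *\<^sub>R b) \<partial>aff_lborel B) \<in> borel_measurable borel"
        by measurable
      note [measurable] = this
      have "(\<integral>\<^sup>+a. ennreal (\<bar>t\<bar> ^ length TB) * (\<integral>\<^sup>+b. f ((1 - t) *\<^sub>R a + t *\<^sub>R b) \<partial>aff_lborel B) \<partial>aff_lborel A)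
          = ennreal (Determinant.det RA) * span_integral TA (\<lambda>a. ennreal (\<bar>t\<bar> ^ length TB) * (\<integral>\<^sup>+b. f ((1 - t) *\<^sub>R a + t *\<^sub>R b) \<partial>aff_lborel B)) v"
        using TA by (intro nn_integral_aff_lborel_QR[OF RA v]) (auto simp: basis_list_of_def)
      also have "\<dots> = ennreal (Determinant.det RA) * (ennreal (Determinant.det RB) *
          span_integral TA (\<lambda>a. span_integral TB f ((1 - t) *\<^sub>R a + t *\<^sub>R w)) v)"
        unfolding 3[symmetric] by (subst span_integral_cmult) auto
      finally have 4: "ennreal (\<bar>t\<bar> ^ length TB) * (\<integral>\<^sup>+a. \<integral>\<^sup>+b. f ((1 - t) *\<^sub>R a + t *\<^sub>R b) \<partial>aff_lborel B \<partial>aff_lborel A)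
         = ennreal (Determinant.det RA * Determinant.det RB) *
          span_integral TA (\<lambda>a. span_integral TB f ((1 - t) *\<^sub>R a + t *\<^sub>R w)) v"
        using pos by (subst (asm) nn_integral_cmult) (auto simp: ennreal_mult mult.assoc)
      have "Determinant.det R = delta A B * (Determinant.det RA * Determinant.det RB)"
        unfolding \<delta> using pos by simp
      moreover have "delta A B > 0" using delta_pos[OF skew ne] .
      ultimately have "ennreal (Determinant.det R) *
          span_integral TA (span_integral TB f) (v + t *\<^sub>R (w - v))
        = ennreal (delta A B * \<bar>1 - t\<bar> ^ length TA) * (ennreal (Determinant.det RA * Determinant.det RB) *
          span_integral TA (\<lambda>a. span_integral TB f ((1 - t) *\<^sub>R a + t *\<^sub>R w)) v)"
        unfolding 1 using pos by (simp add: ennreal_mult mult_ac)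
      then show ?case
        unfolding 4[symmetric] len using \<open>delta A B > 0\<close> by (simp add: ennreal_mult mult_ac)
    qed
  qed
  finally show ?thesis .
qed

text \<open>As an identity of measures the join formula applies to signed integrands and also
  transports integrability.\<close>

lemma aff_lborel_join:
  fixes A B :: "'a::euclidean_space set"
  assumes skew: "affinely_skew A B" and ne: "A \<noteq> {}" "B \<noteq> {}"
  shows "aff_lborel (A \<union> B) =
    distr (density (lborel \<Otimes>\<^sub>M (aff_lborel A \<Otimes>\<^sub>M aff_lborel B))
        (\<lambda>(t, a, b). ennreal (delta A B * (\<bar>1 - t\<bar> ^ nat (aff_dim A) * \<bar>t\<bar> ^ nat (aff_dim B)))))
      borel (\<lambda>(t, a, b). (1 - t) *\<^sub>R a + t *\<^sub>R b)"
proof (rule measure_eqI)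
  interpret B: sigma_finite_measure "aff_lborel B" using ne(2) by (rule sigma_finite_aff_lborel)
  interpret A: sigma_finite_measure "aff_lborel A" using ne(1) by (rule sigma_finite_aff_lborel)
  interpret AB: pair_sigma_finite "aff_lborel A" "aff_lborel B" ..
  interpret AB: sigma_finite_measure "aff_lborel A \<Otimes>\<^sub>M aff_lborel B" by unfold_locales
  fix X assume "X \<in> sets (aff_lborel (A \<union> B))"
  then have [measurable]: "X \<in> sets borel" by simp
  let ?w = "\<lambda>t. ennreal (delta A B * (\<bar>1 - t\<bar> ^ nat (aff_dim A) * \<bar>t\<bar> ^ nat (aff_dim B)))"
  have "emeasure (aff_lborel (A \<union> B)) X = integral\<^sup>N (aff_lborel (A \<union> B)) (indicator X)" by simp
  also have "\<dots> = (\<integral>\<^sup>+t. ?w t * (\<integral>\<^sup>+a. \<integral>\<^sup>+b. indicator X ((1 - t) *\<^sub>R a + t *\<^sub>R b) \<partial>aff_lborel B \<partial>aff_lborel A) \<partial>lborel)"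
    by (rule nn_integral_join[OF skew ne]) measurable
  also have "\<dots> = (\<integral>\<^sup>+t. ?w t * (\<integral>\<^sup>+p. indicator X ((1 - t) *\<^sub>R fst p + t *\<^sub>R snd p) \<partial>(aff_lborel A \<Otimes>\<^sub>M aff_lborel B)) \<partial>lborel)"
    by (subst B.nn_integral_fst[symmetric]) auto
  also have "\<dots> = (\<integral>\<^sup>+t. \<integral>\<^sup>+p. ?w t * indicator X ((1 - t) *\<^sub>R fst p + t *\<^sub>R snd p) \<partial>(aff_lborel A \<Otimes>\<^sub>M aff_lborel B) \<partial>lborel)"
    by (subst nn_integral_cmult) auto
  also have "\<dots> = (\<integral>\<^sup>+q. ?w (fst q) * indicator X ((1 - fst q) *\<^sub>R fst (snd q) + fst q *\<^sub>R snd (snd q))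
      \<partial>(lborel \<Otimes>\<^sub>M (aff_lborel A \<Otimes>\<^sub>M aff_lborel B)))"
    by (subst AB.nn_integral_fst[symmetric]) auto
  also have "\<dots> = integral\<^sup>N (distr (density (lborel \<Otimes>\<^sub>M (aff_lborel A \<Otimes>\<^sub>M aff_lborel B))
        (\<lambda>(t, a, b). ?w t)) borel (\<lambda>(t, a, b). (1 - t) *\<^sub>R a + t *\<^sub>R b)) (indicator X)"
    by (subst nn_integral_distr) (auto simp: nn_integral_density split_beta)
  finally show "emeasure (aff_lborel (A \<union> B)) X = emeasure (distr (density (lborel \<Otimes>\<^sub>M (aff_lborel A \<Otimes>\<^sub>M aff_lborel B))
        (\<lambda>(t, a, b). ?w t)) borel (\<lambda>(t, a, b). (1 - t) *\<^sub>R a + t *\<^sub>R b)) X" by simp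
qed simp

text \<open>By uniqueness of join coordinates the indicator of the join splits into a product of
  indicators, one for each variable.\<close>

lemma join_mem_convex_hull:
  fixes A B :: "'a::euclidean_space set"
  assumes skew: "affinely_skew A B" and A: "convex A" "A \<noteq> {}" and B: "convex B" "B \<noteq> {}"
    and a: "a \<in> affine hull A" and b: "b \<in> affine hull B" and t: "t \<noteq> 0" "t \<noteq> 1"
  shows "(1 - t) *\<^sub>R a + t *\<^sub>R b \<in> convex hull (A \<union> B) \<longleftrightarrow> t \<in> {0..1} \<and> a \<in> A \<and> b \<in> B"
proof
  assume "(1 - t) *\<^sub>R a + t *\<^sub>R b \<in> convex hull (A \<union> B)"
  then obtain u s a' b' where *: "(1 - t) *\<^sub>R a + t *\<^sub>R b = u *\<^sub>R a' + s *\<^sub>R b'"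
    "u \<ge> 0" "s \<ge> 0" "u + s = 1" "a' \<in> A" "b' \<in> B"
    unfolding convex_hull_union_two[OF A B] by blast
  then have "u = 1 - s" by simp
  with * have "t = s" "a = a'" "b = b'"
    using affinely_skew_unique[OF skew a hull_inc[OF *(5)] b hull_inc[OF *(6)], of t s] t by auto
  with * show "t \<in> {0..1} \<and> a \<in> A \<and> b \<in> B" by auto
next
  assume "t \<in> {0..1} \<and> a \<in> A \<and> b \<in> B"
  then show "(1 - t) *\<^sub>R a + t *\<^sub>R b \<in> convex hull (A \<union> B)"
    unfolding convex_hull_union_two[OF A B]
    by (intro CollectI exI[of _ "1 - t"] exI[of _ t] exI[of _ a] exI[of _ b]) auto
qed

section \<open>Decomposition of polytopes\<close>

text \<open>A face of least dimension through \<open>y\<close> works: on its relative boundary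
  \<open>y\<close> would lie in a facet of that face, of smaller dimension.\<close>

lemma polytope_rel_interior_face:
  fixes F :: "'a::euclidean_space set"
  assumes "polytope F" "y \<in> F"
  obtains G where "G face_of F" "y \<in> rel_interior G"
proof -
  have "F face_of F \<and> y \<in> F"
    using assms by (simp add: face_of_refl polytope_imp_convex)
  then obtain G where G: "G face_of F" "y \<in> G"
    and min: "\<And>H. H face_of F \<and> y \<in> H \<Longrightarrow> nat (aff_dim G) \<le> nat (aff_dim H)"
    using ex_has_least_nat[of "\<lambda>G. G face_of F \<and> y \<in> G" F "\<lambda>G. nat (aff_dim G)"] by blast
  have "y \<in> rel_interior G"
  proof (rule ccontr)
    assume "y \<notin> rel_interior G"
    moreover have "polyhedron G"
      using G(1) assms(1) face_of_polytope_polytope polytope_imp_polyhedron by blast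
    ultimately obtain H where H: "H facet_of G" "y \<in> H"
      using rel_boundary_of_polyhedron[of G] G(2) by blast
    then have "H face_of F" using G(1) face_of_trans facet_of_imp_face_of by blast
    with min H have "nat (aff_dim G) \<le> nat (aff_dim H)" by blast
    moreover have "aff_dim H = aff_dim G - 1" "aff_dim H \<ge> 0"
      using H aff_dim_negative_iff[of H] by (auto simp: facet_of_def)
    ultimately show False by linarith
  qed
  with G that show thesis by blast
qed

text \<open>A proper face is the intersection of the facets containing it, so one of these must miss
  \<open>u\<close>.\<close>

lemma face_avoiding_point_subset_facet:
  assumes "polyhedron F" "G face_of F" "G \<noteq> {}" "u \<in> F" "u \<notin> G"
  obtains F' where "F' \<in> opposite_facets u F" "G \<subseteq> F'"
proof -
  have "G \<noteq> F" using assms by auto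
  then have "G = \<Inter>{H. H facet_of F \<and> G \<subseteq> H}" using face_of_polyhedron assms by blast
  then show thesis using assms(5) that by (auto simp: opposite_facets_def)
qed

text \<open>The ray from \<open>u\<close> through \<open>z\<close> is followed to its last point
  \<open>y\<close> in \<open>F\<close>. The face with \<open>y\<close> in its relative interior
  avoids \<open>u\<close>, hence lies in a facet that avoids \<open>u\<close>.\<close>

lemma polytope_cone_over_facets:
  fixes F :: "'a::euclidean_space set"
  assumes F: "polytope F" and u: "u \<in> F" and ne: "F \<noteq> {u}" and z: "z \<in> F"
  obtains F' where "F' \<in> opposite_facets u F" "z \<in> convex hull (insert u F')"
proof -
  have *: "\<exists>F'\<in>opposite_facets u F. z \<in> convex hull (insert u F')" if z: "z \<in> F" "z \<noteq> u" for z
  proof -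
    let ?p = "\<lambda>t. u + t *\<^sub>R (z - u)"
    define T where "T = {t \<in> {0..}. ?p t \<in> F}"
    have "closed (?p -` F)"
      using F polytope_imp_closed by (intro continuous_closed_vimage) (auto intro!: continuous_intros)
    moreover have "T = {0..} \<inter> ?p -` F" by (auto simp: T_def)
    ultimately have "closed T" by (simp add: closed_Int)
    moreover have "bounded T"
    proof -
      obtain B where B: "\<And>x. x \<in> F \<Longrightarrow> norm x \<le> B"
        using polytope_imp_bounded[OF F] by (auto simp: bounded_iff)
      have "\<bar>t\<bar> \<le> (B + norm u) / norm (z - u)" if "t \<in> T" for t
      proof -
        have "norm (t *\<^sub>R (z - u)) \<le> norm (?p t) + norm u"
          using norm_triangle_ineq4[of "?p t" u] by simp
        also have "\<dots> \<le> B + norm u" using B that by (simp add: T_def)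
        finally show ?thesis using z(2) by (simp add: pos_le_divide_eq)
      qed
      then show ?thesis unfolding bounded_iff by (metis real_norm_def)
    qed
    ultimately have "compact T" by (simp add: compact_eq_bounded_closed)
    moreover have "1 \<in> T" using z by (simp add: T_def)
    ultimately obtain t where t: "t \<in> T" "\<And>s. s \<in> T \<Longrightarrow> s \<le> t"
      using compact_attains_sup[of T] by blast
    then have t1: "t \<ge> 1" using \<open>1 \<in> T\<close> by blast
    define y where "y = ?p t"
    have yF: "y \<in> F" using t by (simp add: T_def y_def)
    obtain G where G: "G face_of F" "y \<in> rel_interior G"
      using polytope_rel_interior_face[OF F yF] .
    have yG: "y \<in> G" using G(2) rel_interior_subset by blast
    \<comment> \<open>If \<open>u\<close> were in \<open>G\<close>, the segment from
      \<open>u\<close> to \<open>y\<close> could be prolonged within \<open>G\<close>, against the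
      maximality of \<open>t\<close>.\<close>
    have "u \<notin> G"
    proof
      assume "u \<in> G"
      moreover have "convex G" "G \<noteq> {}" using G(1) face_of_imp_convex yG by auto
      ultimately obtain e where e: "e > 1" "(1 - e) *\<^sub>R u + e *\<^sub>R y \<in> G"
        using convex_rel_interior_iff[of G y] G(2) by blast
      have "(1 - e) *\<^sub>R u + e *\<^sub>R y = ?p (e * t)" by (simp add: y_def algebra_simps)
      then have "e * t \<in> T" using e t1 face_of_imp_subset[OF G(1)] by (auto simp: T_def)
      then have "e * t \<le> t" using t(2) by blast
      then show False using e(1) t1 by simp
    qed
    then obtain F' where F': "F' \<in> opposite_facets u F" "G \<subseteq> F'"
      using face_avoiding_point_subset_facet[OF polytope_imp_polyhedron[OF F] G(1) _ u] yG by blast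
    have "z = (1 - 1 / t) *\<^sub>R u + (1 / t) *\<^sub>R y" using t1 by (simp add: y_def algebra_simps)
    also have "\<dots> \<in> convex hull (insert u F')"
      using t1 F'(2) yG
      by (intro convexD_alt[OF convex_convex_hull]) (auto intro: hull_inc)
    finally show ?thesis using F'(1) by blast
  qed
  show thesis
  proof (cases "z = u")
    case True
    \<comment> \<open>The apex lies in every cone, so only the existence of an opposite facet is at
      stake; it comes from any other point of \<open>F\<close>.\<close>
    obtain x where "x \<in> F" "x \<noteq> u" using ne u by blast
    from *[OF this] obtain F' where "F' \<in> opposite_facets u F" by blast
    then show thesis using that[of F'] True by (simp add: hull_inc)
  next
    case False
    then show thesis using *[OF z] that by blast
  qed
qed

section \<open>One pyramid step in the presence of former apexes\<close>

lemma opposite_facetsD: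
  assumes "F' \<in> opposite_facets u F"
  shows "F' face_of F" "F' \<noteq> {}" "aff_dim F' = aff_dim F - 1" "u \<notin> F'" "F' \<subseteq> F"
  using assms face_of_imp_subset by (auto simp: opposite_facets_def facet_of_def)

lemma finite_opposite_facets: "polytope F \<Longrightarrow> finite (opposite_facets u F)"
  by (rule finite_subset[OF _ finite_polytope_facets]) (auto simp: opposite_facets_def)

text \<open>A face is the intersection of \<open>F\<close> with its own affine hull, so
  \<open>u\<close> lies outside that hull and restores the lost dimension.\<close>

lemma affine_hull_insert_opposite_facet:
  fixes F :: "'a::euclidean_space set"
  assumes "convex F" "u \<in> F" "F' \<in> opposite_facets u F"
  shows "affine hull (insert u F') = affine hull F"
proof -
  note F' = opposite_facetsD[OF assms(3)]
  have "u \<notin> affine hull F'"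
    using face_of_imp_eq_affine_Int[OF assms(1) F'(1)] F'(4) assms(2) by blast
  then have "aff_dim (insert u F') = aff_dim F" using F'(3) by (simp add: aff_dim_insert)
  moreover have "insert u F' \<subseteq> F" using F' assms(2) by auto
  ultimately show ?thesis using aff_dim_eq_full_gen by blast
qed

lemma affine_hull_pyramid_step:
  fixes F :: "'a::euclidean_space set"
  assumes "convex F" "u \<in> F" "F' \<in> opposite_facets u F"
  shows "affine hull (insert u A \<union> F') = affine hull (A \<union> F)"
proof -
  have "affine hull (insert u A \<union> F') = affine hull (A \<union> insert u F')" by simp
  also have "\<dots> = affine hull (A \<union> affine hull (insert u F'))" by (rule hull_Un_right)
  also have "\<dots> = affine hull (A \<union> F)"
    unfolding affine_hull_insert_opposite_facet[OF assms] by (rule hull_Un_right[symmetric])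
  finally show ?thesis .
qed

text \<open>The union keeps its affine hull, \<open>F\<close> loses exactly one dimension and
  \<open>A\<close> gains at most one; the general bound for unions forces equality.\<close>

lemma affinely_skew_pyramid_step:
  fixes F :: "'a::euclidean_space set"
  assumes "convex F" "u \<in> F" "F' \<in> opposite_facets u F" "affinely_skew A F"
  shows "affinely_skew (insert u A) F'"
proof -
  have "aff_dim (insert u A \<union> F') = aff_dim A + aff_dim F + 1"
    using affine_hull_pyramid_step[OF assms(1-3), of A] assms(4)
    by (metis affinely_skew_def aff_dim_affine_hull2)
  moreover have "aff_dim (insert u A) \<le> aff_dim A + 1" by (simp add: aff_dim_insert)
  ultimately show ?thesis
    using opposite_facetsD(3)[OF assms(3)] aff_dim_Un_le[of "insert u A" F']
    unfolding affinely_skew_def by linarith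
qed

lemma convex_hull_UnE:
  fixes A B :: "'a::euclidean_space set"
  assumes "z \<in> convex hull (A \<union> B)" "A \<noteq> {}" "B \<noteq> {}"
  obtains t a b where "z = (1 - t) *\<^sub>R a + t *\<^sub>R b" "0 \<le> t" "t \<le> 1"
    "a \<in> convex hull A" "b \<in> convex hull B"
proof -
  have ne: "convex hull A \<noteq> {}" "convex hull B \<noteq> {}" using assms by simp_all
  have "convex hull (A \<union> B) = convex hull (convex hull A \<union> convex hull B)"
    by (metis hull_Un_left hull_Un_right)
  then have "z \<in> {u *\<^sub>R s + v *\<^sub>R t | u v s t. u \<ge> 0 \<and> v \<ge> 0 \<and> u + v = 1 \<and>
      s \<in> convex hull A \<and> t \<in> convex hull B}"
    using assms(1)
    by (simp only: convex_hull_union_two[OF convex_convex_hull ne(1) convex_convex_hull ne(2)])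
  then obtain u v s t where "z = u *\<^sub>R s + v *\<^sub>R t" "u \<ge> 0" "v \<ge> 0" "u + v = 1"
      "s \<in> convex hull A" "t \<in> convex hull B"
    by blast
  moreover from this have "u = 1 - v" by simp
  ultimately show thesis using that[of v s t] by simp
qed

text \<open>Two points of a facet that does not contain \<open>u\<close> cannot lie on the same ray from \<open>u\<close>.\<close>

lemma cone_over_facets_overlap:
  fixes F :: "'a::euclidean_space set"
  assumes u: "u \<in> F" and F': "F' \<in> opposite_facets u F" and F'': "F'' \<in> opposite_facets u F"
    and x: "x \<in> convex hull (insert u F')" "x \<in> convex hull (insert u F'')"
  shows "x \<in> affine hull (insert u (F' \<inter> F''))"
proof -
  note f' = opposite_facetsD[OF F'] and f'' = opposite_facetsD[OF F'']
  have "convex hull F' = F'" "convex hull F'' = F''"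
    using f'(1) f''(1) by (simp_all add: face_of_imp_convex convex_hull_eq)
  then obtain s y s' y' where
    s: "x = (1 - s) *\<^sub>R u + s *\<^sub>R y" "s \<in> {0..1}" "y \<in> F'" and
    s': "x = (1 - s') *\<^sub>R u + s' *\<^sub>R y'" "s' \<in> {0..1}" "y' \<in> F''"
  proof -
    have "x \<in> {(1 - s) *\<^sub>R u + s *\<^sub>R y |y s. 0 \<le> s \<and> s \<le> 1 \<and> y \<in> F'}"
      "x \<in> {(1 - s) *\<^sub>R u + s *\<^sub>R y |y s. 0 \<le> s \<and> s \<le> 1 \<and> y \<in> F''}"
      using x f'(2) f''(2) \<open>convex hull F' = F'\<close> \<open>convex hull F'' = F''\<close>
      by (simp_all add: convex_hull_insert_alt)
    then show thesis using that by fastforce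
  qed
  \<comment> \<open>Otherwise \<open>w'\<close> would lie strictly between \<open>u\<close> and
    \<open>w\<close>, and the face property would put \<open>u\<close> into the facet. Used in both
    directions it gives \<open>s = s'\<close>.\<close>
  have not_less: "\<not> r < r'"
    if "G \<in> opposite_facets u F" "w \<in> F" "w' \<in> G" "0 < r"
      "(1 - r) *\<^sub>R u + r *\<^sub>R w = (1 - r') *\<^sub>R u + r' *\<^sub>R w'" for r r' w w' G
  proof
    note g = opposite_facetsD[OF that(1)]
    assume less: "r < r'"
    have "r' *\<^sub>R w' = (r' - r) *\<^sub>R u + r *\<^sub>R w" using that(5) by (simp add: algebra_simps)
    then have "inverse r' *\<^sub>R (r' *\<^sub>R w') = inverse r' *\<^sub>R ((r' - r) *\<^sub>R u + r *\<^sub>R w)" by simp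
    then have w': "w' = (1 - r / r') *\<^sub>R u + (r / r') *\<^sub>R w"
      using that(4) less by (simp add: scaleR_add_right divide_inverse algebra_simps)
    moreover have "w \<noteq> u" using w' that(3) g(4) by (auto simp: algebra_simps)
    ultimately have "w' \<in> open_segment u w"
      using that(4) less unfolding in_segment by (auto intro!: exI[of _ "r / r'"])
    then have "u \<in> G" using face_ofD[OF g(1)] that(2,3) u by blast
    then show False using g(4) by blast
  qed
  show ?thesis
  proof (cases "s = 0 \<or> s' = 0")
    case True
    then have "x = u" using s s' by auto
    then show ?thesis by (simp add: hull_inc)
  next
    case False
    then have pos: "s > 0" "s' > 0" using s(2) s'(2) by auto
    have "s = s'"
      using not_less[OF F' _ s(3) pos(2), of y' s] not_less[OF F'' _ s'(3) pos(1), of y s']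
        s(1,3) s'(1,3) f'(5) f''(5) by force
    then have "y = y'" using s(1) s'(1) pos by simp
    then have "y \<in> F' \<inter> F''" using s(3) s'(3) by simp
    then show ?thesis unfolding s(1)
      by (intro mem_affine[OF affine_affine_hull]) (auto intro: hull_inc)
  qed
qed

text \<open>Uniqueness of join coordinates reduces the claim to cones: the part of \<open>z\<close>
  in the affine hull of \<open>F\<close> is the same point in both representations, so it lies in
  both cones with apex \<open>u\<close>.\<close>

lemma join_overlap:
  fixes F :: "'a::euclidean_space set"
  assumes F: "polytope F" and u: "u \<in> F" and skew: "affinely_skew A F"
    and F': "F' \<in> opposite_facets u F" and F'': "F'' \<in> opposite_facets u F"
    and z: "z \<in> convex hull (insert u A \<union> F')" "z \<in> convex hull (insert u A \<union> F'')"
  shows "z \<in> affine hull (insert u A \<union> (F' \<inter> F''))"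
proof (cases "A = {}")
  case True
  then show ?thesis using cone_over_facets_overlap[OF u F' F''] z by simp
next
  case False
  note f' = opposite_facetsD[OF F'] and f'' = opposite_facetsD[OF F'']
  have decomp: "\<exists>t a x. z = (1 - t) *\<^sub>R a + t *\<^sub>R x \<and> a \<in> convex hull A \<and> x \<in> convex hull (insert u G)"
    if "z \<in> convex hull (insert u A \<union> G)" for G
    using convex_hull_UnE[of z A "insert u G"] that False by (metis Un_insert_left Un_insert_right insert_not_empty)
  obtain t a x where 1: "z = (1 - t) *\<^sub>R a + t *\<^sub>R x" "a \<in> convex hull A" "x \<in> convex hull (insert u F')"
    using decomp[OF z(1)] by blast
  obtain t' a' x' where 2: "z = (1 - t') *\<^sub>R a' + t' *\<^sub>R x'" "a' \<in> convex hull A" "x' \<in> convex hull (insert u F'')"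
    using decomp[OF z(2)] by blast
  have hull: "convex hull (insert u F') \<subseteq> affine hull F" "convex hull (insert u F'') \<subseteq> affine hull F"
    using f'(5) f''(5) u hull_mono[of _ F convex] convex_hull_subset_affine_hull[of F]
    by (metis insert_subset order_trans)+
  have A: "a \<in> affine hull A" "a' \<in> affine hull A"
    using 1 2 convex_hull_subset_affine_hull by blast+
  have "t \<noteq> 0 \<Longrightarrow> x = x'"
    using affinely_skew_unique(3)[OF skew A, of x x' t t'] 1 2 hull by auto
  then have x: "t \<noteq> 0 \<Longrightarrow> x \<in> affine hull (insert u (F' \<inter> F''))"
    using cone_over_facets_overlap[OF u F' F''] 1 2 by simp
  let ?H = "affine hull (insert u A \<union> (F' \<inter> F''))"
  have sub: "affine hull (insert u (F' \<inter> F'')) \<subseteq> ?H" "affine hull A \<subseteq> ?H"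
    by (auto intro!: hull_mono)
  show ?thesis
  proof (cases "t = 0")
    case True
    then show ?thesis using 1 A sub by auto
  next
    case False
    then show ?thesis unfolding 1(1) using x A sub
      by (intro mem_affine[OF affine_affine_hull]) auto
  qed
qed

text \<open>Two different facets meet in a proper face of each, so the overlap falls at least two
  dimensions below \<open>F\<close>, of which the new apex restores only one.\<close>

lemma aff_dim_join_overlap:
  fixes F :: "'a::euclidean_space set"
  assumes "polytope F" "affinely_skew A F"
    and F': "F' \<in> opposite_facets u F" and F'': "F'' \<in> opposite_facets u F" and ne: "F' \<noteq> F''"
  shows "aff_dim (insert u A \<union> (F' \<inter> F'')) < aff_dim (A \<union> F)"
proof -
  note f' = opposite_facetsD[OF F'] and f'' = opposite_facetsD[OF F'']
  have conv: "convex F'" "convex F''" using f' f'' face_of_imp_convex by blast+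
  have "F' \<inter> F'' \<noteq> F'"
  proof
    assume "F' \<inter> F'' = F'"
    then have "F' face_of F''" using f'(1) f''(1,5) face_of_subset[of F' F F''] by blast
    then show False using face_of_aff_dim_lt[OF conv(2), of F'] ne f'(3) f''(3) by simp
  qed
  moreover have "(F' \<inter> F'') face_of F'"
    using f' f'' face_of_Int face_of_subset[of "F' \<inter> F''" F F'] by blast
  ultimately have "aff_dim (F' \<inter> F'') < aff_dim F'" using face_of_aff_dim_lt[OF conv(1)] by blast
  moreover have "aff_dim (insert u A) \<le> aff_dim A + 1" by (simp add: aff_dim_insert)
  ultimately show ?thesis
    using aff_dim_Un_le[of "insert u A" "F' \<inter> F''"] f'(3) assms(2)
    unfolding affinely_skew_def by linarith
qed

lemma convex_hull_pyramid_step: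
  fixes F :: "'a::euclidean_space set"
  assumes F: "polytope F" and u: "u \<in> F" and ne: "F \<noteq> {u}"
  shows "convex hull (A \<union> F) = (\<Union>F'\<in>opposite_facets u F. convex hull (insert u A \<union> F'))"
proof
  show "(\<Union>F'\<in>opposite_facets u F. convex hull (insert u A \<union> F')) \<subseteq> convex hull (A \<union> F)"
    using u opposite_facetsD(5) by (intro UN_least hull_mono) blast
  show "convex hull (A \<union> F) \<subseteq> (\<Union>F'\<in>opposite_facets u F. convex hull (insert u A \<union> F'))"
  proof
    fix z assume z: "z \<in> convex hull (A \<union> F)"
    have "\<exists>F'\<in>opposite_facets u F. z \<in> convex hull (insert u A \<union> F')"
    proof (cases "A = {}")
      case True
      then have "z \<in> F" using z hull_same[of convex F] F polytope_imp_convex by force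
      then show ?thesis using polytope_cone_over_facets[OF F u ne] True by auto
    next
      case False
      have conv: "convex hull F = F" using F by (simp add: convex_hull_eq polytope_imp_convex)
      have "F \<noteq> {}" using u by blast
      from convex_hull_UnE[OF z False this, unfolded conv]
      obtain t a x where *: "z = (1 - t) *\<^sub>R a + t *\<^sub>R x" "0 \<le> t" "t \<le> 1"
        "a \<in> convex hull A" "x \<in> F" .
      obtain F' where F': "F' \<in> opposite_facets u F" "x \<in> convex hull (insert u F')"
        using polytope_cone_over_facets[OF F u ne *(5)] .
      let ?H = "convex hull (insert u A \<union> F')"
      have "convex hull A \<subseteq> ?H" "convex hull (insert u F') \<subseteq> ?H" by (auto intro!: hull_mono)
      then have "z \<in> ?H" unfolding *(1) using * F'(2)
        by (intro convexD[OF convex_convex_hull]) auto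
      then show ?thesis using F'(1) by blast
    qed
    then show "z \<in> (\<Union>F'\<in>opposite_facets u F. convex hull (insert u A \<union> F'))" by blast
  qed
qed

text \<open>Off the finitely many flats that contain the overlaps, a point of the join lies in
  exactly one piece. The form as a sum of real indicators can be multiplied by the
  integrand.\<close>

lemma AE_indicator_pyramid_step:
  fixes F :: "'a::euclidean_space set"
  assumes F: "polytope F" and u: "u \<in> F" and ne: "F \<noteq> {u}" and skew: "affinely_skew A F"
  shows "AE z in aff_lborel (A \<union> F). indicator (convex hull (A \<union> F)) z =
    (\<Sum>F'\<in>opposite_facets u F. indicator (convex hull (insert u A \<union> F')) z :: real)"
proof -
  have "A \<union> F \<noteq> {}" using u by auto
  note fin = finite_opposite_facets[OF F, of u]
  have "AE z in aff_lborel (A \<union> F). \<forall>(F', F'')\<in>{(F', F'') \<in> opposite_facets u F \<times> opposite_facets u F. F' \<noteq> F''}.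
      z \<notin> affine hull (insert u A \<union> (F' \<inter> F''))"
  proof (rule AE_finite_allI)
    show "finite {(F', F'') \<in> opposite_facets u F \<times> opposite_facets u F. F' \<noteq> F''}"
      by (rule finite_subset[OF _ finite_cartesian_product[OF fin fin]]) auto
  qed (use AE_not_in_smaller_affine_hull[OF \<open>A \<union> F \<noteq> {}\<close>] aff_dim_join_overlap[OF F skew] in auto)
  then show ?thesis
  proof eventually_elim
    case (elim z)
    show ?case
    proof (cases "z \<in> convex hull (A \<union> F)")
      case True
      then obtain F' where F': "F' \<in> opposite_facets u F" "z \<in> convex hull (insert u A \<union> F')"
        using convex_hull_pyramid_step[OF F u ne] by blast
      have "z \<notin> convex hull (insert u A \<union> F'')" if "F'' \<in> opposite_facets u F - {F'}" for F''
        using join_overlap[OF F u skew F'(1) _ F'(2)] elim F'(1) that by blast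
      then have "(\<Sum>F''\<in>opposite_facets u F - {F'}. indicator (convex hull (insert u A \<union> F'')) z :: real) = 0"
        by (intro sum.neutral) (auto simp: indicator_def)
      then have "(\<Sum>F''\<in>opposite_facets u F. indicator (convex hull (insert u A \<union> F'')) z :: real) = 1"
        using sum.remove[OF fin F'(1), of "\<lambda>F''. indicator (convex hull (insert u A \<union> F'')) z :: real"] F'(2)
        by simp
      then show ?thesis using True by simp
    next
      case False
      then show ?thesis using convex_hull_pyramid_step[OF F u ne, of A]
        by (auto simp: indicator_def intro!: sum.neutral[symmetric])
    qed
  qed
qed

section \<open>Paths of the decomposition and the tiling by joins\<close>

text \<open>Paths from \<open>F\<close> to any leaf, in contrast to \<open>pyr_paths\<close>, which
  fixes the last face. Leaving the end open yields a recursion along the first step.\<close>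

definition pyr_leaf_paths :: "'a::euclidean_space set \<Rightarrow> ('a set \<Rightarrow> 'a) \<Rightarrow> 'a set \<Rightarrow> 'a set list set" where
  "pyr_leaf_paths S apex F =
     {Fs. Fs \<noteq> [] \<and> hd Fs = F \<and> successively (pyr_step S apex) Fs \<and> singular_vertices S (last Fs) = {}}"

lemma pyr_paths_eq:
  "singular_vertices S B = {} \<Longrightarrow> pyr_paths F S apex B = {Fs \<in> pyr_leaf_paths S apex F. last Fs = B}"
  unfolding pyr_paths_def pyr_leaf_paths_def successively_conv_nth by auto

lemma pyr_leaf_paths_leaf:
  assumes "singular_vertices S F = {}"
  shows "pyr_leaf_paths S apex F = {[F]}"
proof -
  have "Fs = [F]" if "Fs \<in> pyr_leaf_paths S apex F" for Fs
    using that assms unfolding pyr_leaf_paths_def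
    by (cases Fs) (auto simp: successively_Cons pyr_step_def)
  moreover have "[F] \<in> pyr_leaf_paths S apex F"
    using assms by (simp add: pyr_leaf_paths_def)
  ultimately show ?thesis by blast
qed

lemma pyr_leaf_paths_step:
  assumes "singular_vertices S F \<noteq> {}"
  shows "pyr_leaf_paths S apex F =
    (\<Union>F'\<in>opposite_facets (apex F) F. (#) F ` pyr_leaf_paths S apex F')" (is "?L = ?R")
proof (rule antisym; rule subsetI)
  fix Fs assume Fs: "Fs \<in> ?L"
  then obtain Gs where Gs: "Fs = F # Gs" unfolding pyr_leaf_paths_def by (cases Fs) auto
  with Fs assms have "Gs \<noteq> []" by (auto simp: pyr_leaf_paths_def)
  with Fs Gs have "hd Gs \<in> opposite_facets (apex F) F" "Gs \<in> pyr_leaf_paths S apex (hd Gs)"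
    by (auto simp: pyr_leaf_paths_def successively_Cons pyr_step_def)
  with Gs show "Fs \<in> ?R" by blast
next
  fix Fs assume "Fs \<in> ?R"
  then show "Fs \<in> ?L"
    using assms by (auto simp: pyr_leaf_paths_def successively_Cons pyr_step_def)
qed

text \<open>Induction on the dimension of \<open>F\<close>, with \<open>A\<close> collecting the
  apexes used so far. Positive dimension at faces with a singular vertex is essential: a single
  singular point has no opposite facets, and its piece would be lost from the tiling.\<close>

lemma pyr_leaf_paths_tiling:
  fixes P :: "'a::euclidean_space set"
  assumes P: "polytope P" and apex: "apex_choice P S apex"
    and nosing: "\<And>F F'. F face_of P \<Longrightarrow> singular_vertices S F \<noteq> {} \<Longrightarrow>
      F' \<in> opposite_facets (apex F) F \<Longrightarrow> singular_vertices S F' \<noteq> {} \<Longrightarrow> aff_dim F' > 0"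
  assumes "F face_of P" "F \<noteq> {}" "singular_vertices S F \<noteq> {} \<longrightarrow> aff_dim F > 0" "affinely_skew A F"
  shows "finite (pyr_leaf_paths S apex F) \<and>
    (\<forall>Fs\<in>pyr_leaf_paths S apex F.
       affinely_skew (A \<union> apex ` set (butlast Fs)) (last Fs) \<and>
       affine hull (A \<union> apex ` set (butlast Fs) \<union> last Fs) = affine hull (A \<union> F) \<and>
       last Fs face_of P \<and> last Fs \<noteq> {} \<and> apex ` set (butlast Fs) \<subseteq> S \<inter> P) \<and>
    (AE z in aff_lborel (A \<union> F). indicator (convex hull (A \<union> F)) z =
      (\<Sum>Fs\<in>pyr_leaf_paths S apex F.
         indicator (convex hull (A \<union> apex ` set (butlast Fs) \<union> last Fs)) z :: real))"
  using assms(4-7)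
proof (induction "nat (aff_dim F)" arbitrary: F A rule: less_induct)
  case less
  show ?case
  proof (cases "singular_vertices S F = {}")
    case True
    then show ?thesis using less.prems by (simp add: pyr_leaf_paths_leaf)
  next
    case False
    let ?u = "apex F" let ?O = "opposite_facets (apex F) F" let ?T = "pyr_leaf_paths S apex"
    have F: "polytope F" using P less.prems(1) by (rule face_of_polytope_polytope)
    have conv: "convex F" using F polytope_imp_convex by blast
    have uS: "?u \<in> singular_vertices S F"
      using apex less.prems(1) False by (auto simp: apex_choice_def)
    then have u: "?u \<in> S" "?u \<in> F" by (auto simp: singular_vertices_def extreme_point_of_def)
    have uP: "?u \<in> P" using u face_of_imp_subset[OF less.prems(1)] by blast
    have pos: "aff_dim F > 0" using less.prems(3) False by blast
    then have ne: "F \<noteq> {?u}" by (metis aff_dim_sing less_irrefl)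
    \<comment> \<open>The induction hypothesis for \<open>F'\<close> with
      \<open>insert ?u A\<close>, carried over to the unchanged affine hull and therefore to the
      same measure.\<close>
    have IH: "finite (?T F') \<and>
      (\<forall>Fs\<in>?T F'.
         affinely_skew (insert ?u A \<union> apex ` set (butlast Fs)) (last Fs) \<and>
         affine hull (insert ?u A \<union> apex ` set (butlast Fs) \<union> last Fs) = affine hull (A \<union> F) \<and>
         last Fs face_of P \<and> last Fs \<noteq> {} \<and> apex ` set (butlast Fs) \<subseteq> S \<inter> P) \<and>
      (AE z in aff_lborel (A \<union> F). indicator (convex hull (insert ?u A \<union> F')) z =
        (\<Sum>Fs\<in>?T F'.
           indicator (convex hull (insert ?u A \<union> apex ` set (butlast Fs) \<union> last Fs)) z :: real))"
      if F': "F' \<in> ?O" for F'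
    proof -
      note f' = opposite_facetsD[OF F']
      have hull: "affine hull (insert ?u A \<union> F') = affine hull (A \<union> F)"
        using affine_hull_pyramid_step[OF conv u(2) F'] .
      show ?thesis
        using less.hyps[of F' "insert ?u A"] f' pos nosing[OF less.prems(1) False F']
          face_of_trans[OF f'(1) less.prems(1)]
          affinely_skew_pyramid_step[OF conv u(2) F' less.prems(4)]
        unfolding hull aff_lborel_cong[OF hull] by auto
    qed
    note T = pyr_leaf_paths_step[OF False, of apex]
    have fin: "finite (?T F)"
      unfolding T using IH finite_opposite_facets[OF F] by blast
    have nil: "Fs \<noteq> []" if "Fs \<in> ?T F'" for Fs F' using that by (simp add: pyr_leaf_paths_def)
    have all: "affinely_skew (A \<union> apex ` set (butlast Fs)) (last Fs) \<and>
       affine hull (A \<union> apex ` set (butlast Fs) \<union> last Fs) = affine hull (A \<union> F) \<and>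
       last Fs face_of P \<and> last Fs \<noteq> {} \<and> apex ` set (butlast Fs) \<subseteq> S \<inter> P" if Fs: "Fs \<in> ?T F" for Fs
    proof -
      obtain F' Gs where *: "F' \<in> ?O" "Gs \<in> ?T F'" "Fs = F # Gs" using Fs unfolding T by blast
      then show ?thesis using IH[OF *(1)] nil[OF *(2)] u uP by auto
    qed
    have "AE z in aff_lborel (A \<union> F). \<forall>F'\<in>?O. indicator (convex hull (insert ?u A \<union> F')) z =
        (\<Sum>Fs\<in>?T F'. indicator (convex hull (insert ?u A \<union> apex ` set (butlast Fs) \<union> last Fs)) z :: real)"
      using IH finite_opposite_facets[OF F] by (intro AE_finite_allI) auto
    with AE_indicator_pyramid_step[OF F u(2) ne less.prems(4)]
    have "AE z in aff_lborel (A \<union> F). indicator (convex hull (A \<union> F)) z =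
      (\<Sum>Fs\<in>?T F. indicator (convex hull (A \<union> apex ` set (butlast Fs) \<union> last Fs)) z :: real)"
    proof eventually_elim
      case (elim z)
      let ?f = "\<lambda>Fs. indicator (convex hull (A \<union> apex ` set (butlast Fs) \<union> last Fs)) z :: real"
      \<comment> \<open>Paths through different facets differ in their second entry, so the union
        over the facets is disjoint.\<close>
      have "(\<Sum>Fs\<in>?T F. ?f Fs) = (\<Sum>F'\<in>?O. \<Sum>Fs\<in>(#) F ` ?T F'. ?f Fs)"
        unfolding T
      proof (rule sum.UNION_disjoint)
        show "\<forall>F'\<in>?O. \<forall>F''\<in>?O. F' \<noteq> F'' \<longrightarrow> (#) F ` ?T F' \<inter> (#) F ` ?T F'' = {}"
          by (auto simp: pyr_leaf_paths_def)
      qed (use IH finite_opposite_facets[OF F] in auto)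
      also have "\<dots> = (\<Sum>F'\<in>?O. \<Sum>Fs\<in>?T F'. ?f (F # Fs))"
        by (intro sum.cong sum.reindex_cong[of "(#) F"]) auto
      also have "\<dots> = (\<Sum>F'\<in>?O. \<Sum>Fs\<in>?T F'. indicator (convex hull (insert ?u A \<union> apex ` set (butlast Fs) \<union> last Fs)) z)"
        using nil by (intro sum.cong refl) auto
      finally show ?case using elim by simp
    qed
    with fin all show ?thesis by blast
  qed
qed

lemma rtranclp_pyr_step_path:
  assumes "successively (pyr_step S apex) Fs" "Fs \<noteq> []"
  shows "(pyr_step S apex)\<^sup>*\<^sup>* (hd Fs) (last Fs)"
  using assms
proof (induction Fs)
  case (Cons F Fs)
  then show ?case
    by (cases "Fs = []") (auto simp: successively_Cons intro: converse_rtranclp_into_rtranclp)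
qed simp

lemma rtranclp_pyr_step_face:
  assumes "(pyr_step S apex)\<^sup>*\<^sup>* P B" "convex P" "P \<noteq> {}"
  shows "B face_of P \<and> B \<noteq> {}"
  using assms
proof (induction rule: rtranclp_induct)
  case base
  then show ?case by (simp add: face_of_refl)
next
  case (step F F')
  then show ?case using opposite_facetsD(1,2) face_of_trans unfolding pyr_step_def by blast
qed

section \<open>The integral formula\<close>

text \<open>The inner double integral can be iterated only for almost every \<open>x\<close>, where
  the section is integrable; the outer integral ignores the exceptional set.\<close>

lemma integral_prod3:
  fixes f :: "_ \<Rightarrow> real"
  assumes M: "sigma_finite_measure M1" "sigma_finite_measure M2" "sigma_finite_measure M3"
    and f: "integrable (M1 \<Otimes>\<^sub>M (M2 \<Otimes>\<^sub>M M3)) f"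
  shows "integral\<^sup>L (M1 \<Otimes>\<^sub>M (M2 \<Otimes>\<^sub>M M3)) f = (\<integral>x. \<integral>y. \<integral>z. f (x, y, z) \<partial>M3 \<partial>M2 \<partial>M1)"
proof -
  interpret M1: sigma_finite_measure M1 by fact
  interpret M2: sigma_finite_measure M2 by fact
  interpret M3: sigma_finite_measure M3 by fact
  interpret M23: pair_sigma_finite M2 M3 ..
  interpret M123: pair_sigma_finite M1 "M2 \<Otimes>\<^sub>M M3" ..
  have [measurable]: "f \<in> borel_measurable (M1 \<Otimes>\<^sub>M (M2 \<Otimes>\<^sub>M M3))" using f by simp
  have "integral\<^sup>L (M1 \<Otimes>\<^sub>M (M2 \<Otimes>\<^sub>M M3)) f = (\<integral>x. \<integral>p. f (x, p) \<partial>(M2 \<Otimes>\<^sub>M M3) \<partial>M1)"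
    by (rule M123.integral_fst'[OF f, symmetric])
  also have "\<dots> = (\<integral>x. \<integral>y. \<integral>z. f (x, y, z) \<partial>M3 \<partial>M2 \<partial>M1)"
  proof (rule integral_cong_AE)
    show "AE x in M1. (\<integral>p. f (x, p) \<partial>(M2 \<Otimes>\<^sub>M M3)) = (\<integral>y. \<integral>z. f (x, y, z) \<partial>M3 \<partial>M2)"
      using M123.AE_integrable_fst'[OF f] by eventually_elim (rule M23.integral_fst'[symmetric])
  qed measurable
  finally show ?thesis .
qed

lemma integral_prod4:
  fixes f :: "_ \<Rightarrow> real"
  assumes M: "sigma_finite_measure M1" "sigma_finite_measure M2" "sigma_finite_measure M3"
      "sigma_finite_measure M4"
    and f: "integrable (M1 \<Otimes>\<^sub>M (M2 \<Otimes>\<^sub>M (M3 \<Otimes>\<^sub>M M4))) f"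
  shows "integral\<^sup>L (M1 \<Otimes>\<^sub>M (M2 \<Otimes>\<^sub>M (M3 \<Otimes>\<^sub>M M4))) f
    = (\<integral>w. \<integral>x. \<integral>y. \<integral>z. f (w, x, y, z) \<partial>M4 \<partial>M3 \<partial>M2 \<partial>M1)"
proof -
  interpret M1: sigma_finite_measure M1 by fact
  interpret M2: sigma_finite_measure M2 by fact
  interpret M3: sigma_finite_measure M3 by fact
  interpret M4: sigma_finite_measure M4 by fact
  interpret M34: pair_sigma_finite M3 M4 ..
  interpret M234: pair_sigma_finite M2 "M3 \<Otimes>\<^sub>M M4" ..
  interpret M1234: pair_sigma_finite M1 "M2 \<Otimes>\<^sub>M (M3 \<Otimes>\<^sub>M M4)" ..
  have [measurable]: "f \<in> borel_measurable (M1 \<Otimes>\<^sub>M (M2 \<Otimes>\<^sub>M (M3 \<Otimes>\<^sub>M M4)))" using f by simp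
  have "integral\<^sup>L (M1 \<Otimes>\<^sub>M (M2 \<Otimes>\<^sub>M (M3 \<Otimes>\<^sub>M M4))) f
      = (\<integral>w. \<integral>p. f (w, p) \<partial>(M2 \<Otimes>\<^sub>M (M3 \<Otimes>\<^sub>M M4)) \<partial>M1)"
    by (rule M1234.integral_fst'[OF f, symmetric])
  also have "\<dots> = (\<integral>w. \<integral>x. \<integral>y. \<integral>z. f (w, x, y, z) \<partial>M4 \<partial>M3 \<partial>M2 \<partial>M1)"
  proof (rule integral_cong_AE)
    show "AE w in M1. (\<integral>p. f (w, p) \<partial>(M2 \<Otimes>\<^sub>M (M3 \<Otimes>\<^sub>M M4)))
        = (\<integral>x. \<integral>y. \<integral>z. f (w, x, y, z) \<partial>M4 \<partial>M3 \<partial>M2)"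
      using M1234.AE_integrable_fst'[OF f]
      by eventually_elim (rule integral_prod3[OF M(2-4)])
  qed measurable
  finally show ?thesis .
qed

lemma integral_join:
  fixes A :: "('a::euclidean_space \<times> 'b::euclidean_space) set" and X :: "'a set" and Y :: "'b set"
    and G :: "'a \<times> 'b \<Rightarrow> real"
  assumes skew: "affinely_skew A (X \<times> Y)"
    and A: "convex A" "closed A" "A \<noteq> {}" and X: "convex X" "closed X" "X \<noteq> {}"
    and Y: "convex Y" "closed Y" "Y \<noteq> {}"
    and G [measurable]: "G \<in> borel_measurable borel"
    and int: "integrable (aff_lborel (A \<union> X \<times> Y)) (\<lambda>z. indicator (convex hull (A \<union> X \<times> Y)) z * G z)"
    and cl: "closed (convex hull (A \<union> X \<times> Y))"
  shows "(\<integral>z. indicator (convex hull (A \<union> X \<times> Y)) z * G z \<partial>aff_lborel (A \<union> X \<times> Y)) =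
    delta A (X \<times> Y) * (LINT t:{0..1}|lborel.
      (LINT a:A|aff_lborel A. LINT x:X|aff_lborel X. LINT y:Y|aff_lborel Y.
         G ((1 - t) *\<^sub>R a + t *\<^sub>R (x, y)))
      * ((1 - t) ^ nat (aff_dim A) * t ^ nat (aff_dim (X \<times> Y))))"
proof -
  let ?B = "X \<times> Y" let ?C = "convex hull (A \<union> X \<times> Y)"
  let ?w = "\<lambda>t. (1 - t) ^ nat (aff_dim A) * t ^ nat (aff_dim (X \<times> Y))"
  let ?N = "aff_lborel A \<Otimes>\<^sub>M (aff_lborel X \<Otimes>\<^sub>M aff_lborel Y)"
  let ?M = "(lborel :: real measure) \<Otimes>\<^sub>M ?N"
  let ?\<phi> = "\<lambda>q. (1 - fst q) *\<^sub>R fst (snd q) + fst q *\<^sub>R snd (snd q)"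
  let ?W = "\<lambda>q. delta A ?B * (\<bar>1 - fst q\<bar> ^ nat (aff_dim A) * \<bar>fst q\<bar> ^ nat (aff_dim ?B))"
  have B: "convex ?B" "?B \<noteq> {}" using X Y by (auto intro: convex_Times)
  have \<delta>: "delta A ?B > 0" using delta_pos[OF skew A(3) B(2)] .
  have [measurable]: "A \<in> sets borel" "X \<in> sets borel" "Y \<in> sets borel" "?C \<in> sets borel"
    using A X Y cl by auto
  have [measurable_cong]: "sets ?N = sets (borel \<Otimes>\<^sub>M (borel \<Otimes>\<^sub>M borel))"
    by (intro sets_pair_measure_cong sets_aff_lborel)
  have sf: "sigma_finite_measure (aff_lborel A)" "sigma_finite_measure (aff_lborel X)"
    "sigma_finite_measure (aff_lborel Y)"
    using A X Y by (simp_all add: sigma_finite_aff_lborel)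
  interpret A: sigma_finite_measure "aff_lborel A" by fact
  interpret X: sigma_finite_measure "aff_lborel X" by fact
  interpret Y: sigma_finite_measure "aff_lborel Y" by fact
  interpret XY: pair_sigma_finite "aff_lborel X" "aff_lborel Y" ..
  interpret AXY: pair_sigma_finite "aff_lborel A" "aff_lborel X \<Otimes>\<^sub>M aff_lborel Y" ..
  interpret LAXY: pair_sigma_finite lborel ?N ..
  have B_eq: "aff_lborel X \<Otimes>\<^sub>M aff_lborel Y = aff_lborel ?B"
    using aff_lborel_Times[OF X(3) Y(3)] .
  have \<phi> [measurable]: "?\<phi> \<in> ?M \<rightarrow>\<^sub>M borel"
    unfolding B_eq by measurable
  have join: "aff_lborel (A \<union> ?B) = distr (density ?M (\<lambda>q. ennreal (?W q))) borel ?\<phi>"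
    unfolding B_eq using aff_lborel_join[OF skew A(3) B(2)] by (simp add: split_beta')
  have W: "AE q in ?M. 0 \<le> ?W q" using \<delta> by simp
  have H [measurable]: "(\<lambda>z. indicator ?C z * G z) \<in> borel_measurable borel" by measurable
  have "integrable (distr (density ?M (\<lambda>q. ennreal (?W q))) borel ?\<phi>) (\<lambda>z. indicator ?C z * G z)"
    using int unfolding join .
  then have int2: "integrable ?M (\<lambda>q. ?W q * (indicator ?C (?\<phi> q) * G (?\<phi> q)))"
    using W by (subst (asm) integrable_distr_eq) (auto simp: integrable_density)
  have eq1: "(\<integral>z. indicator ?C z * G z \<partial>aff_lborel (A \<union> ?B))
      = (\<integral>q. ?W q * (indicator ?C (?\<phi> q) * G (?\<phi> q)) \<partial>?M)"
    unfolding join using W by (subst integral_distr) (auto simp: integral_density)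
  \<comment> \<open>The integrand in join coordinates, with the indicators nested in the order of
    integration so that each one can be pulled out at its own integral.\<close>
  define K where "K = (\<lambda>q. delta A ?B * (indicator {0..1} (fst q) * (?w (fst q) *
     (indicator A (fst (snd q)) * (indicator X (fst (snd (snd q))) *
     (indicator Y (snd (snd (snd q))) * G (?\<phi> q)))))))"
  have K [measurable]: "K \<in> borel_measurable ?M" unfolding K_def by measurable
  \<comment> \<open>Away from \<open>t = 0\<close>, \<open>t = 1\<close> and points off the affine
    hulls, join coordinates are unique and the indicator of the join factors.\<close>
  have ae: "AE q in ?M. ?W q * (indicator ?C (?\<phi> q) * G (?\<phi> q)) = K q"
  proof -
    have [measurable]: "affine hull A \<in> sets borel" "affine hull ?B \<in> sets borel" by simp_all
    have "AE a in aff_lborel A. AE b in aff_lborel X \<Otimes>\<^sub>M aff_lborel Y.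
        a \<in> affine hull A \<and> b \<in> affine hull ?B"
      using AE_affine_hull[OF A(3)] AE_affine_hull[OF B(2)] unfolding B_eq by auto
    moreover have "{p \<in> space ?N. fst p \<in> affine hull A \<and> snd p \<in> affine hull ?B} \<in> sets ?N"
      unfolding B_eq by measurable
    ultimately have aeN: "AE p in ?N. fst p \<in> affine hull A \<and> snd p \<in> affine hull ?B"
      by (intro AXY.AE_pair_measure) auto
    have "AE t in lborel. t \<noteq> (0::real) \<and> t \<noteq> 1"
      using AE_lborel_singleton[of "0::real"] AE_lborel_singleton[of "1::real"] by auto
    then have "AE t in lborel. AE p in ?N. t \<noteq> (0::real) \<and> t \<noteq> 1 \<and> fst p \<in> affine hull A \<and> snd p \<in> affine hull ?B"
    proof (rule eventually_mono)
      fix t :: real assume t: "t \<noteq> 0 \<and> t \<noteq> 1"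
      show "AE p in ?N. t \<noteq> 0 \<and> t \<noteq> 1 \<and> fst p \<in> affine hull A \<and> snd p \<in> affine hull ?B"
        using aeN by (rule eventually_mono) (use t in simp)
    qed
    moreover have "{q \<in> space ?M. fst q \<noteq> 0 \<and> fst q \<noteq> 1 \<and> fst (snd q) \<in> affine hull A \<and>
        snd (snd q) \<in> affine hull ?B} \<in> sets ?M"
      unfolding B_eq by measurable
    ultimately have "AE q in ?M. fst q \<noteq> 0 \<and> fst q \<noteq> 1 \<and> fst (snd q) \<in> affine hull A \<and> snd (snd q) \<in> affine hull ?B"
      by (intro LAXY.AE_pair_measure) auto
    then show ?thesis
    proof eventually_elim
      case (elim q)
      obtain t a x y where q: "q = (t, a, x, y)" by (metis prod.exhaust)
      have mem: "(1 - t) *\<^sub>R a + t *\<^sub>R (x, y) \<in> ?C \<longleftrightarrow> t \<in> {0..1} \<and> a \<in> A \<and> (x, y) \<in> ?B"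
        using elim unfolding q fst_conv snd_conv by (intro join_mem_convex_hull[OF skew A(1,3) B]) auto
      show ?case
      proof (cases "t \<in> {0..1} \<and> a \<in> A \<and> (x, y) \<in> ?B")
        case True
        then show ?thesis using mem unfolding K_def q fst_conv snd_conv by simp
      next
        case False
        then have "indicator {0..1} t = (0::real) \<or> indicator A a = (0::real) \<or>
          indicator X x = (0::real) \<or> indicator Y y = (0::real)" by (auto simp: indicator_def)
        moreover have "indicator ?C ((1 - t) *\<^sub>R a + t *\<^sub>R (x, y)) = (0::real)"
          using mem False by (metis indicator_simps(2))
        ultimately show ?thesis unfolding K_def q fst_conv snd_conv by auto
      qed
    qed
  qed
  have intK: "integrable ?M K"
    using int2 integrable_cong_AE[OF _ K ae] by (simp add: borel_measurable_integrable)
  have "(\<integral>z. indicator ?C z * G z \<partial>aff_lborel (A \<union> ?B)) = integral\<^sup>L ?M K"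
    unfolding eq1 using int2 by (intro integral_cong_AE K ae) (rule borel_measurable_integrable)
  also have "\<dots> = (\<integral>t. \<integral>a. \<integral>x. \<integral>y. K (t, a, x, y) \<partial>aff_lborel Y \<partial>aff_lborel X \<partial>aff_lborel A \<partial>lborel)"
    by (rule integral_prod4[OF lborel.sigma_finite_measure_axioms sf intK])
  also have "\<dots> = delta A ?B * (LINT t:{0..1}|lborel.
      ?w t * (LINT a:A|aff_lborel A. LINT x:X|aff_lborel X. LINT y:Y|aff_lborel Y.
         G ((1 - t) *\<^sub>R a + t *\<^sub>R (x, y))))"
    \<comment> \<open>Constants leave Bochner integrals without any integrability condition, which
      suits inner integrals known to exist only almost everywhere.\<close>
    unfolding K_def set_lebesgue_integral_def fst_conv snd_conv real_scaleR_def
      integral_mult_right_zero ..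
  finally show ?thesis by (simp only: mult.commute)
qed

section \<open>From leaves and paths to the double sum\<close>

text \<open>Finiteness guards against the default value 0 of infinite sums. Leaves are nonempty, so
  their factors are determined; the empty set would be a product in many ways.\<close>

lemma finite_pyr_leaf_pairs:
  assumes "polytope X" "X \<noteq> {}" "polytope Y" "Y \<noteq> {}"
  shows "finite {(Fx, Fy). Fx \<times> Fy \<in> pyr_leaves (X \<times> Y) S apex}"
    and "\<And>Fx Fy. Fx \<times> Fy \<in> pyr_leaves (X \<times> Y) S apex \<Longrightarrow> Fx \<noteq> {} \<and> Fy \<noteq> {}"
proof -
  have *: "B face_of X \<times> Y \<and> B \<noteq> {}" if "B \<in> pyr_leaves (X \<times> Y) S apex" for B
    using that assms rtranclp_pyr_step_face[of S apex "X \<times> Y" B]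
    by (auto simp: pyr_leaves_def convex_Times polytope_imp_convex)
  show "Fx \<noteq> {} \<and> Fy \<noteq> {}" if "Fx \<times> Fy \<in> pyr_leaves (X \<times> Y) S apex" for Fx Fy
    using *[OF that] by auto
  have "{(Fx, Fy). Fx \<times> Fy \<in> pyr_leaves (X \<times> Y) S apex} \<subseteq> {F. F face_of X} \<times> {F. F face_of Y}"
    using * by (fastforce simp: face_of_Times_eq)
  then show "finite {(Fx, Fy). Fx \<times> Fy \<in> pyr_leaves (X \<times> Y) S apex}"
    by (rule finite_subset) (simp add: assms finite_polytope_faces)
qed

text \<open>A path determines its leaf, and a nonempty product determines its factors as
  projections; summing over leaves and then paths is thus a single sum over all paths.\<close>

lemma sum_pyr_leaves:
  fixes X :: "'a::euclidean_space set" and Y :: "'b::euclidean_space set"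
    and T :: "'a set \<Rightarrow> 'b set \<Rightarrow> ('a \<times> 'b) set list \<Rightarrow> real"
  assumes X: "polytope X" "X \<noteq> {}" and Y: "polytope Y" "Y \<noteq> {}"
    and fin: "finite (pyr_leaf_paths S apex (X \<times> Y))"
  shows "(\<Sum>(Fx, Fy)\<in>{(Fx, Fy). Fx \<times> Fy \<in> pyr_leaves (X \<times> Y) S apex}.
      \<Sum>Fs\<in>pyr_paths (X \<times> Y) S apex (Fx \<times> Fy). T Fx Fy Fs)
    = (\<Sum>Fs\<in>pyr_leaf_paths S apex (X \<times> Y). T (fst ` last Fs) (snd ` last Fs) Fs)"
proof -
  let ?L = "{(Fx, Fy). Fx \<times> Fy \<in> pyr_leaves (X \<times> Y) S apex}"
  let ?P = "\<lambda>B. pyr_paths (X \<times> Y) S apex B" let ?T = "pyr_leaf_paths S apex (X \<times> Y)"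
  note L = finite_pyr_leaf_pairs[OF X Y, where S = S and apex = apex]
  have P: "?P (Fx \<times> Fy) = {Fs \<in> ?T. last Fs = Fx \<times> Fy}" if "(Fx, Fy) \<in> ?L" for Fx Fy
    using that by (intro pyr_paths_eq) (auto simp: pyr_leaves_def)
  have leaf: "last Fs \<in> pyr_leaves (X \<times> Y) S apex" if "Fs \<in> ?T" for Fs
    using that rtranclp_pyr_step_path[of S apex Fs] by (auto simp: pyr_leaves_def pyr_leaf_paths_def)
  have prod: "last Fs = fst ` last Fs \<times> snd ` last Fs" if "Fs \<in> ?T" for Fs
  proof -
    have "last Fs face_of X \<times> Y \<and> last Fs \<noteq> {}"
      using leaf[OF that] X Y rtranclp_pyr_step_face[of S apex "X \<times> Y" "last Fs"]
      by (auto simp: pyr_leaves_def convex_Times polytope_imp_convex)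
    then obtain Fx Fy where "last Fs = Fx \<times> Fy" "Fx \<noteq> {}" "Fy \<noteq> {}"
      by (auto simp: face_of_Times_decomp)
    then show ?thesis by simp
  qed
  have "(\<Sum>(Fx, Fy)\<in>?L. \<Sum>Fs\<in>?P (Fx \<times> Fy). T Fx Fy Fs)
      = (\<Sum>p\<in>?L. \<Sum>Fs\<in>?P (fst p \<times> snd p). T (fst p) (snd p) Fs)"
    by (simp add: split_beta')
  also have "\<dots> = (\<Sum>(p, Fs)\<in>Sigma ?L (\<lambda>p. ?P (fst p \<times> snd p)). T (fst p) (snd p) Fs)"
  proof (rule sum.Sigma[OF L(1)], rule ballI)
    fix p assume p: "p \<in> ?L"
    show "finite (?P (fst p \<times> snd p))" using P[of "fst p" "snd p"] p fin by auto
  qed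
  also have "\<dots> = (\<Sum>Fs\<in>?T. T (fst ` last Fs) (snd ` last Fs) Fs)"
  proof (rule sum.reindex_bij_witness[of _ "\<lambda>Fs. ((fst ` last Fs, snd ` last Fs), Fs)" snd])
    fix q assume q: "q \<in> Sigma ?L (\<lambda>p. ?P (fst p \<times> snd p))"
    obtain Fx Fy Fs where q': "q = ((Fx, Fy), Fs)" by (metis prod.exhaust)
    then have 1: "Fx \<times> Fy \<in> pyr_leaves (X \<times> Y) S apex" "Fs \<in> ?P (Fx \<times> Fy)" using q by auto
    then have 2: "Fs \<in> ?T" "last Fs = Fx \<times> Fy" using P[of Fx Fy] by auto
    have ne: "Fx \<noteq> {}" "Fy \<noteq> {}" using L(2)[OF 1(1)] by auto
    show "((fst ` last (snd q), snd ` last (snd q)), snd q) = q" "snd q \<in> ?T"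
      "T (fst ` last (snd q)) (snd ` last (snd q)) (snd q) = (case q of (p, Fs) \<Rightarrow> T (fst p) (snd p) Fs)"
      using q' 2 ne by auto
  next
    fix Fs assume Fs: "Fs \<in> ?T"
    have p: "(fst ` last Fs, snd ` last Fs) \<in> ?L" using leaf[OF Fs] prod[OF Fs] by simp
    show "((fst ` last Fs, snd ` last Fs), Fs) \<in> Sigma ?L (\<lambda>p. ?P (fst p \<times> snd p))"
      using p P[OF p] Fs prod[OF Fs] by simp
  qed simp
  finally show ?thesis .
qed

theorem theorem5p3:
  fixes Px Py :: "(real ^ 'n) set"
    and U :: "((real ^ 'n) \<times> (real ^ 'n)) set"
    and g :: "(real ^ 'n) \<times> (real ^ 'n) \<Rightarrow> real"
    and \<alpha> :: real
    and apex :: "((real ^ 'n) \<times> (real ^ 'n)) set \<Rightarrow> (real ^ 'n) \<times> (real ^ 'n)"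
  assumes "polytope Px" and "Px \<noteq> {}"
    and "polytope Py" and "Py \<noteq> {}"
    and "\<not> (\<exists>a b. Px = {a} \<and> Py = {b})"
    and "Px \<inter> Py \<noteq> {}" and "(Px \<inter> Py) face_of Px" and "(Px \<inter> Py) face_of Py"
    and "open U" and "Px \<times> Py \<subseteq> U" and "smooth_on U g"
    and "set_integrable (aff_lborel (Px \<times> Py)) (Px \<times> Py) (\<lambda>(x, y). norm (x - y) powr (- \<alpha>))"
    and "apex_choice (Px \<times> Py) (diag_vertices (Px \<inter> Py)) apex"
  shows
    "(LINT x:Px|aff_lborel Px. LINT y:Py|aff_lborel Py. norm (x - y) powr (- \<alpha>) * g (x, y)) =
     (\<Sum>(Fx, Fy) \<in> {(Fx, Fy). Fx \<times> Fy \<in> pyr_leaves (Px \<times> Py) (diag_vertices (Px \<inter> Py)) apex}.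
      \<Sum>Fs \<in> pyr_paths (Px \<times> Py) (diag_vertices (Px \<inter> Py)) apex (Fx \<times> Fy).
        let A = path_simplex apex Fs;
            r = aff_dim Fx + aff_dim Fy;
            s = aff_dim Px + aff_dim Py - r - 1
        in delta A (Fx \<times> Fy) *
           (LINT t:{0..1}|lborel.
              (LINT z:A|aff_lborel A. LINT xF:Fx|aff_lborel Fx. LINT yF:Fy|aff_lborel Fy.
                 norm (xF - yF) powr (- \<alpha>) *
                 g ((1 - t) *\<^sub>R fst z + t *\<^sub>R xF, (1 - t) *\<^sub>R fst z + t *\<^sub>R yF))
              * (1 - t) powi s * t powr (real_of_int r - \<alpha>)))"
proof -
  let ?P = "Px \<times> Py" let ?S = "diag_vertices (Px \<inter> Py)"
  let ?M = "aff_lborel (Px \<times> Py)"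
  let ?T = "pyr_leaf_paths ?S apex ?P"
  \<comment> \<open>The indicator makes the product with \<open>g\<close> Borel measurable on the
    whole space, since \<open>g\<close> is controlled only on \<open>U\<close>.\<close>
  define G where "G = (\<lambda>p. norm (fst p - snd p) powr (- \<alpha>) * (indicator ?P p * g p))"
  note X = assms(1,2) and Y = assms(3,4)
  have P: "polytope ?P" "?P \<noteq> {}" using X Y by (auto intro: polytope_Times)
  have Pc: "convex ?P" "compact ?P" "closed ?P"
    using P(1) polytope_imp_convex polytope_imp_compact polytope_imp_closed by blast+
  have [measurable]: "?P \<in> sets borel" using Pc(3) by simp
  have "Ck_on 0 U g" using assms(11) unfolding smooth_on_def by blast
  then have cont: "continuous_on ?P g" using assms(10) continuous_on_subset by simp
  have [measurable]: "(\<lambda>p. indicator ?P p * g p) \<in> borel_measurable borel"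
    using borel_measurable_continuous_on_indicator[OF _ cont] by simp
  have G [measurable]: "G \<in> borel_measurable borel"
  proof -
    have "(\<lambda>p::(real ^ 'n) \<times> (real ^ 'n). fst p - snd p) \<in> borel \<rightarrow>\<^sub>M borel"
      by (intro borel_measurable_continuous_onI continuous_intros)
    then have "(\<lambda>p::(real ^ 'n) \<times> (real ^ 'n). norm (fst p - snd p) powr (- \<alpha>)) \<in> borel_measurable borel"
      by measurable
    then show ?thesis unfolding G_def by measurable
  qed
  have intG: "integrable ?M G"
  proof -
    \<comment> \<open>A bound for \<open>g\<close> on the compact product turns integrability of the
      kernel into that of \<open>G\<close>.\<close>
    obtain C where C: "\<And>p. p \<in> ?P \<Longrightarrow> \<bar>g p\<bar> \<le> C"
      using compact_imp_bounded[OF compact_continuous_image[OF cont Pc(2)]] by (auto simp: bounded_iff)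
    let ?h = "\<lambda>p. C * (indicator ?P p *\<^sub>R (case p of (x, y) \<Rightarrow> norm (x - y) powr (- \<alpha>)))"
    have "integrable ?M ?h"
      using assms(12) unfolding set_integrable_def by (intro integrable_mult_right) auto
    then show ?thesis
    proof (rule Bochner_Integration.integrable_bound)
      show "AE p in ?M. norm (G p) \<le> norm (?h p)"
      proof (rule AE_I2)
        fix p
        show "norm (G p) \<le> norm (?h p)"
          using C[of p] by (auto simp: G_def indicator_def abs_mult split_beta mult.commute
              intro!: mult_right_mono order_trans[OF _ abs_ge_self])
      qed
    qed simp
  qed
  have "aff_dim ?P > 0"
  proof (rule ccontr)
    assume "\<not> aff_dim ?P > 0"
    moreover have "aff_dim ?P \<ge> 0" using P(2) aff_dim_negative_iff[of ?P] by linarith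
    ultimately obtain p where "?P = {p}" using aff_dim_eq_0[of ?P] by force
    then have "Px = {fst p} \<and> Py = {snd p}" using X Y by (metis fst_image_times image_empty image_insert snd_image_times)
    then show False using assms(5) by blast
  qed
  \<comment> \<open>A vertex of the common face yields a singular vertex of the product, so the
    product itself is no leaf and every path has an apex.\<close>
  obtain v where v: "v extreme_point_of (Px \<inter> Py)"
    using extreme_point_exists_convex[of "Px \<inter> Py"] assms(6) X Y polytope_imp_compact polytope_imp_convex
      compact_Int convex_Int by metis
  have "v extreme_point_of Px" "v extreme_point_of Py"
    using v extreme_point_of_face assms(7,8) by blast+
  then have "{v} \<times> {v} face_of ?P" by (intro face_of_Times) (simp_all add: face_of_singleton)
  then have sing: "singular_vertices ?S ?P \<noteq> {}"
    using v by (auto simp: singular_vertices_def diag_vertices_def face_of_singleton)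
  have nosing: "aff_dim F' > 0"
    if F: "F face_of ?P" "singular_vertices ?S F \<noteq> {}" and F': "F' \<in> opposite_facets (apex F) F"
      and s': "singular_vertices ?S F' \<noteq> {}" for F F'
  proof -
    note f' = opposite_facetsD[OF F']
    have "apex F \<in> singular_vertices ?S F" using assms(13) F by (auto simp: apex_choice_def)
    then obtain w where w: "apex F = (w, w)" "(w, w) \<in> F"
      by (auto simp: singular_vertices_def diag_vertices_def extreme_point_of_def)
    obtain w' where w': "(w', w') \<in> F'"
      using s' by (auto simp: singular_vertices_def diag_vertices_def extreme_point_of_def)
    have "w \<noteq> w'" using w w' f'(4) by auto
    obtain Fx Fy where Fxy: "F = Fx \<times> Fy" using F(1) by (auto simp: face_of_Times_decomp)
    then have ww: "w \<in> Fx" "w' \<in> Fx" "w \<in> Fy" "w' \<in> Fy" using w w' f'(5) by auto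
    have "aff_dim Z \<ge> 1" if "w \<in> Z" "w' \<in> Z" for Z
    proof -
      have "aff_dim {w, w'} \<le> aff_dim Z" using that by (intro aff_dim_subset) auto
      then show ?thesis using \<open>w \<noteq> w'\<close> by (simp add: aff_dim_2)
    qed
    then have "aff_dim Fx \<ge> 1" "aff_dim Fy \<ge> 1" using ww by blast+
    moreover have "Fx \<noteq> {}" "Fy \<noteq> {}" using ww by blast+
    ultimately have "aff_dim F \<ge> 2" unfolding Fxy by (simp add: aff_dim_Times)
    then show ?thesis using f'(3) by simp
  qed
  \<comment> \<open>The tiling started without any former apex.\<close>
  have tile0: "finite ?T \<and>
    (\<forall>Fs\<in>?T. affinely_skew ({} \<union> apex ` set (butlast Fs)) (last Fs) \<and>
       affine hull ({} \<union> apex ` set (butlast Fs) \<union> last Fs) = affine hull ({} \<union> ?P) \<and>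
       last Fs face_of ?P \<and> last Fs \<noteq> {} \<and> apex ` set (butlast Fs) \<subseteq> ?S \<inter> ?P) \<and>
    (AE z in aff_lborel ({} \<union> ?P). indicator (convex hull ({} \<union> ?P)) z =
      (\<Sum>Fs\<in>?T. indicator (convex hull ({} \<union> apex ` set (butlast Fs) \<union> last Fs)) z :: real))"
    using \<open>aff_dim ?P > 0\<close> P Pc
    by (intro pyr_leaf_paths_tiling[OF P(1) assms(13) nosing]) (auto simp: face_of_refl affinely_skew_def)
  note tile = tile0[unfolded sup_bot_left]
  let ?J = "\<lambda>Fs. convex hull (apex ` set (butlast Fs) \<union> last Fs)"
  have hullP: "convex hull ?P = ?P" using Pc(1) by (rule hull_same)
  have sub: "?J Fs \<subseteq> ?P" if "Fs \<in> ?T" for Fs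
    using tile that face_of_imp_subset Pc(1) by (intro hull_minimal) auto
  have Jcl: "closed (?J Fs)" if "Fs \<in> ?T" for Fs
  proof -
    have "polytope (last Fs)" using tile that P(1) face_of_polytope_polytope by blast
    then have "compact (apex ` set (butlast Fs) \<union> last Fs)"
      by (simp add: compact_Un finite_imp_compact polytope_imp_compact)
    then show ?thesis by (simp add: compact_convex_hull compact_imp_closed)
  qed
  have intJ: "integrable ?M (\<lambda>p. indicator (?J Fs) p * G p)" if "Fs \<in> ?T" for Fs
    using intG Jcl[OF that] integrable_mult_indicator[of "?J Fs" ?M G] by simp
  interpret SX: sigma_finite_measure "aff_lborel Px" using X(2) by (rule sigma_finite_aff_lborel)
  interpret SY: sigma_finite_measure "aff_lborel Py" using Y(2) by (rule sigma_finite_aff_lborel)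
  interpret SXY: pair_sigma_finite "aff_lborel Px" "aff_lborel Py" ..
  have "(LINT x:Px|aff_lborel Px. LINT y:Py|aff_lborel Py. norm (x - y) powr (- \<alpha>) * g (x, y))
      = (\<integral>x. \<integral>y. G (x, y) \<partial>aff_lborel Py \<partial>aff_lborel Px)"
    unfolding set_lebesgue_integral_def G_def
    by (simp add: indicator_times mult_ac flip: integral_mult_right_zero)
  also have "\<dots> = integral\<^sup>L ?M G"
    using SXY.integral_fst'[of G] intG unfolding aff_lborel_Times[OF X(2) Y(2)] by simp
  also have "\<dots> = (\<integral>p. (\<Sum>Fs\<in>?T. indicator (?J Fs) p * G p) \<partial>?M)"
  proof (rule integral_cong_AE)
    show "(\<lambda>p. \<Sum>Fs\<in>?T. indicator (?J Fs) p * G p) \<in> borel_measurable ?M"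
      using intJ by (intro borel_measurable_sum) (auto dest: borel_measurable_integrable)
    have "AE z in ?M. indicator ?P z = (\<Sum>Fs\<in>?T. indicator (?J Fs) z :: real)"
      using tile hullP by simp
    then show "AE p in ?M. G p = (\<Sum>Fs\<in>?T. indicator (?J Fs) p * G p)"
    proof eventually_elim
      case (elim p)
      \<comment> \<open>\<open>G\<close> vanishes outside the product, so the almost everywhere
        partition of its indicator can be inserted.\<close>
      have "G p = indicator ?P p * G p" by (simp add: G_def indicator_def)
      then show ?case unfolding elim by (simp add: sum_distrib_right)
    qed
  qed simp
  also have "\<dots> = (\<Sum>Fs\<in>?T. \<integral>p. indicator (?J Fs) p * G p \<partial>?M)"
    using intJ by (rule Bochner_Integration.integral_sum)
  also have "\<dots> = (\<Sum>Fs\<in>?T.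
        let Fx = fst ` last Fs; Fy = snd ` last Fs; A = path_simplex apex Fs;
            r = aff_dim Fx + aff_dim Fy;
            s = aff_dim Px + aff_dim Py - r - 1
        in delta A (Fx \<times> Fy) *
           (LINT t:{0..1}|lborel.
              (LINT z:A|aff_lborel A. LINT xF:Fx|aff_lborel Fx. LINT yF:Fy|aff_lborel Fy.
                 norm (xF - yF) powr (- \<alpha>) *
                 g ((1 - t) *\<^sub>R fst z + t *\<^sub>R xF, (1 - t) *\<^sub>R fst z + t *\<^sub>R yF))
              * (1 - t) powi s * t powr (real_of_int r - \<alpha>)))"
  proof (rule sum.cong[OF refl])
    fix Fs assume Fs: "Fs \<in> ?T"
    let ?V = "apex ` set (butlast Fs)"
    define A where "A = path_simplex apex Fs"
    have Adef: "A = convex hull ?V" by (simp add: A_def path_simplex_def)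
    have skew0: "affinely_skew ?V (last Fs)" and hull0: "affine hull (?V \<union> last Fs) = affine hull ?P"
      and face: "last Fs face_of ?P" "last Fs \<noteq> {}" and V: "?V \<subseteq> ?S" "?V \<subseteq> ?P"
      using tile Fs by auto
    obtain Fx Fy where F: "Fx face_of Px" "Fy face_of Py" "last Fs = Fx \<times> Fy"
      using face(1) by (auto simp: face_of_Times_decomp)
    have ne: "Fx \<noteq> {}" "Fy \<noteq> {}" using face(2) F(3) by auto
    have im: "fst ` last Fs = Fx" "snd ` last Fs = Fy" using ne unfolding F(3) by simp_all
    have poly: "polytope Fx" "polytope Fy" using F X Y face_of_polytope_polytope by blast+
    have hullA: "affine hull (A \<union> Fx \<times> Fy) = affine hull ?P"
      using hull0 unfolding Adef F(3)[symmetric]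
      by (metis affine_hull_convex_hull hull_Un_left)
    have skew: "affinely_skew A (Fx \<times> Fy)"
    proof -
      have "aff_dim (A \<union> Fx \<times> Fy) = aff_dim (?V \<union> Fx \<times> Fy)"
        using hullA hull0 unfolding F(3) by (intro aff_dim_affine_hull2) simp
      moreover have "aff_dim A = aff_dim ?V" unfolding Adef by (rule aff_dim_convex_hull)
      ultimately show ?thesis using skew0 unfolding affinely_skew_def F(3) by simp
    qed
    have J: "?J Fs = convex hull (A \<union> Fx \<times> Fy)"
      unfolding Adef F(3) by (rule hull_Un_left)
    have M: "?M = aff_lborel (A \<union> Fx \<times> Fy)" using hullA by (intro aff_lborel_cong) simp
    have "butlast Fs \<noteq> []"
      using Fs sing by (cases Fs) (auto simp: pyr_leaf_paths_def split: if_splits)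
    then have A: "convex A" "closed A" "A \<noteq> {}"
      unfolding Adef by (simp_all add: compact_imp_closed finite_imp_compact_convex_hull)
    have AP: "A \<subseteq> ?P" unfolding Adef using V(2) Pc(1) by (rule hull_minimal)
    \<comment> \<open>The diagonal is convex and contains all apexes, hence also their
      simplex.\<close>
    have diag: "snd z = fst z" if "z \<in> A" for z
    proof -
      have "convex {z. snd z = fst z}" for z by (auto simp: convex_def)
      then have "A \<subseteq> {z. snd z = fst z}"
        unfolding Adef using V(1) by (intro hull_minimal) (auto simp: diag_vertices_def)
      then show ?thesis using that by blast
    qed
    define r where "r = aff_dim Fx + aff_dim Fy"
    define s where "s = aff_dim Px + aff_dim Py - r - 1"
    have r: "aff_dim (Fx \<times> Fy) = r" unfolding r_def using ne by (rule aff_dim_Times)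
    have "aff_dim (A \<union> Fx \<times> Fy) = aff_dim Px + aff_dim Py"
      using aff_dim_affine_hull2[OF hullA] aff_dim_Times[OF X(2) Y(2)] by simp
    \<comment> \<open>Skewness reads dim A + r + 1 = dim Px + dim Py, which identifies the exponent
      of 1 - \<lambda> as dim A.\<close>
    then have s: "aff_dim A = s" using skew r unfolding affinely_skew_def s_def by simp
    have r0: "r \<ge> 0" unfolding r_def using ne aff_dim_negative_iff[of Fx] aff_dim_negative_iff[of Fy] by linarith
    have s0: "s \<ge> 0" unfolding s[symmetric] using A(3) aff_dim_negative_iff[of A] by linarith
    let ?I = "\<lambda>t. LINT z:A|aff_lborel A. LINT x:Fx|aff_lborel Fx. LINT y:Fy|aff_lborel Fy.
                 norm (x - y) powr (- \<alpha>) *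
                 g ((1 - t) *\<^sub>R fst z + t *\<^sub>R x, (1 - t) *\<^sub>R fst z + t *\<^sub>R y)"
    let ?K = "\<lambda>t. LINT z:A|aff_lborel A. LINT x:Fx|aff_lborel Fx. LINT y:Fy|aff_lborel Fy.
                 G ((1 - t) *\<^sub>R z + t *\<^sub>R (x, y))"
    have GI: "G ((1 - t) *\<^sub>R z + t *\<^sub>R (x, y)) = t powr (- \<alpha>) * (norm (x - y) powr (- \<alpha>) *
                 g ((1 - t) *\<^sub>R fst z + t *\<^sub>R x, (1 - t) *\<^sub>R fst z + t *\<^sub>R y))"
      if t: "t \<in> {0..1}" and zxy: "z \<in> A" "x \<in> Fx" "y \<in> Fy" for t z x y
    proof -
      have p: "(1 - t) *\<^sub>R z + t *\<^sub>R (x, y) = ((1 - t) *\<^sub>R fst z + t *\<^sub>R x, (1 - t) *\<^sub>R fst z + t *\<^sub>R y)"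
        using diag[OF zxy(1)] by (simp add: prod_eq_iff)
      have "(x, y) \<in> ?P" using zxy F face_of_imp_subset by blast
      then have "(1 - t) *\<^sub>R z + t *\<^sub>R (x, y) \<in> ?P"
        using AP zxy t by (intro convexD_alt[OF Pc(1)]) auto
      \<comment> \<open>The diagonal contribution of the apexes has cancelled in the difference, and
        homogeneity extracts the power of \<open>t\<close>.\<close>
      moreover have "norm (t *\<^sub>R x - t *\<^sub>R y) powr (- \<alpha>) = t powr (- \<alpha>) * norm (x - y) powr (- \<alpha>)"
        using t by (simp add: powr_mult flip: scaleR_diff_right)
      ultimately show ?thesis unfolding G_def p by simp
    qed
    have KI: "?K t = t powr (- \<alpha>) * ?I t" if t: "t \<in> {0..1}" for t
    proof -
      have "?K t = (LINT z:A|aff_lborel A. LINT x:Fx|aff_lborel Fx. LINT y:Fy|aff_lborel Fy.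
          t powr (- \<alpha>) * (norm (x - y) powr (- \<alpha>) *
                 g ((1 - t) *\<^sub>R fst z + t *\<^sub>R x, (1 - t) *\<^sub>R fst z + t *\<^sub>R y)))"
        by (intro set_lebesgue_integral_cong allI impI GI[OF t])
           (use A poly in \<open>simp_all add: polytope_imp_closed\<close>)
      then show ?thesis by (simp add: set_integral_mult_right)
    qed
    have "(\<integral>p. indicator (?J Fs) p * G p \<partial>?M) = delta A (Fx \<times> Fy) * (LINT t:{0..1}|lborel.
        ?K t * ((1 - t) ^ nat s * t ^ nat r))"
      unfolding M J r[symmetric] s[symmetric]
      using intJ[OF Fs, unfolded M J] Jcl[OF Fs, unfolded J] poly ne
      by (intro integral_join skew A G) (auto simp: polytope_imp_convex polytope_imp_closed)
    also have "(LINT t:{0..1}|lborel. ?K t * ((1 - t) ^ nat s * t ^ nat r))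
        = (LINT t:{0..1}|lborel. ?I t * (1 - t) powi s * t powr (real_of_int r - \<alpha>))"
    proof (intro set_lebesgue_integral_cong allI impI)
      fix t :: real assume t: "t \<in> {0..1}"
      show "?K t * ((1 - t) ^ nat s * t ^ nat r) = ?I t * (1 - t) powi s * t powr (real_of_int r - \<alpha>)"
      \<comment> \<open>At 0 both sides vanish, since \<open>0 powr _ = 0\<close>; for positive
        \<open>t\<close> the factor from the kernel and the power r combine by the law of
        exponents.\<close>
      proof (cases "t = 0")
        case True
        then show ?thesis using KI[OF t] by simp
      next
        case False
        then have "t > 0" using t by simp
        then have t_pow: "t powr (real_of_int r - \<alpha>) = t ^ nat r * t powr (- \<alpha>)"
          using r0 by (simp add: powr_realpow[symmetric] powr_add[symmetric])
        have s_pow: "(1 - t) powi s = (1 - t) ^ nat s" using s0 by (simp add: power_int_def)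
        show ?thesis unfolding KI[OF t] t_pow s_pow by (simp only: mult_ac)
      qed
    qed simp
    finally show "(\<integral>p. indicator (?J Fs) p * G p \<partial>?M) =
        (let Fx = fst ` last Fs; Fy = snd ` last Fs; A = path_simplex apex Fs;
            r = aff_dim Fx + aff_dim Fy;
            s = aff_dim Px + aff_dim Py - r - 1
        in delta A (Fx \<times> Fy) *
           (LINT t:{0..1}|lborel.
              (LINT z:A|aff_lborel A. LINT xF:Fx|aff_lborel Fx. LINT yF:Fy|aff_lborel Fy.
                 norm (xF - yF) powr (- \<alpha>) *
                 g ((1 - t) *\<^sub>R fst z + t *\<^sub>R xF, (1 - t) *\<^sub>R fst z + t *\<^sub>R yF))
              * (1 - t) powi s * t powr (real_of_int r - \<alpha>)))"
      unfolding Let_def im A_def[symmetric] r_def[symmetric] s_def[symmetric] .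
  qed
  finally show ?thesis
    using tile unfolding sum_pyr_leaves[OF X Y, of ?S apex, OF conjunct1[OF tile]] by (simp add: Let_def)
qed

end
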